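(* Let $p$ be an odd prime and for a $p$-adic integer $x$ and $n\in\mathbb{N}$ put $$t_n(x)=\sum_{k=0}^n\binom{n}{k}\binom{x}{k}\binom{x+k}{k}2^k.$$ Then for any $p$-adic integer $x\not\equiv-1/2\pmod p$, $$\sum_{n=0}^{p-1}(n+1)t_n(x)^2\equiv\frac{p}{4}-\frac{(-1)^{\langle x\rangle_p}(2x^2+2x-1)(p+2(x-\langle x\rangle_p))}{8x+4}\pmod{p^2},$$ and for any $p$-adic integer $x\equiv-1/2\pmod p$, $$\sum_{n=0}^{p-1}(n+1)t_n(x)^2\equiv\frac{p}{4}+\frac{3}{8}\left(\frac{-1}{p}\right)\pmod{p^2}.$$
   Context: For a $p$-adic integer $x$ and $k\in\mathbb{N}$, $\binom{x}{k}=x(x-1)\cdots(x-k+1)/k!$. $\langle x\rangle_p$ denotes the least nonnegative residue of $x$ modulo $p$, i.e. the unique integer in $\{0,1,\dots,p-1\}$ congruent to $x$ modulo $p$. $\left(\frac{\cdot}{p}\right)$ is the Legendre symbol. Congruences are understood in $\mathbb{Z}_p$. *)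

theory Defs
  imports
    "HOL-Computational_Algebra.Polynomial_Factorial"
    "HOL-Number_Theory.Number_Theory"
    "Berlekamp_Zassenhaus.Finite_Field"
begin

text \<open>
  The ring of \<open>p\<close>-adic integers is the inverse limit of \<open>\<int>/p\<^sup>n\<int>\<close>: an element is a
  compatible sequence of residues, the \<open>n\<close>-th one being represented in \<open>{0..<p\<^sup>n}\<close>. The prime
  \<open>p\<close> is the cardinality of the index type \<open>'p\<close>.
\<close>

typedef (overloaded) ('p :: prime_card) padic_int =
  "{x :: nat \<Rightarrow> int. \<forall>n. x n \<in> {0..<int CARD('p) ^ n} \<and> x (Suc n) mod int CARD('p) ^ n = x n}"
  morphisms padic_residue Abs_padic_int
  by (rule exI[of _ "\<lambda>_. 0"]) (auto simp: prime_gt_0_nat[OF prime_card])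

setup_lifting type_definition_padic_int

lemma card_pow_pos [simp]: "0 < int CARD('p :: prime_card) ^ n"
  using prime_gt_0_nat[OF prime_card[where 'a = 'p]] by simp

lemma mod_card_pow_Suc:
  "(a :: int) mod int CARD('p :: prime_card) ^ Suc n mod int CARD('p) ^ n = a mod int CARD('p) ^ n"
  by (rule mod_mod_cancel) (simp add: le_imp_power_dvd)

instantiation padic_int :: (prime_card) comm_ring_1
begin

lift_definition zero_padic_int :: "'a padic_int" is "\<lambda>_. 0"
  by auto

lift_definition one_padic_int :: "'a padic_int" is "\<lambda>n. 1 mod int CARD('a) ^ n"
  by (simp only: mod_card_pow_Suc) auto

lift_definition plus_padic_int :: "'a padic_int \<Rightarrow> 'a padic_int \<Rightarrow> 'a padic_int"
  is "\<lambda>x y n. (x n + y n) mod int CARD('a) ^ n"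
  by (simp only: mod_card_pow_Suc) (auto, metis mod_add_eq)

lift_definition minus_padic_int :: "'a padic_int \<Rightarrow> 'a padic_int \<Rightarrow> 'a padic_int"
  is "\<lambda>x y n. (x n - y n) mod int CARD('a) ^ n"
  by (simp only: mod_card_pow_Suc) (auto, metis mod_diff_eq)

lift_definition uminus_padic_int :: "'a padic_int \<Rightarrow> 'a padic_int"
  is "\<lambda>x n. (- x n) mod int CARD('a) ^ n"
  by (simp only: mod_card_pow_Suc) (auto, metis mod_minus_eq)

lift_definition times_padic_int :: "'a padic_int \<Rightarrow> 'a padic_int \<Rightarrow> 'a padic_int"
  is "\<lambda>x y n. (x n * y n) mod int CARD('a) ^ n"
  by (simp only: mod_card_pow_Suc) (auto, metis mod_mult_eq)

instance
proof
  fix a b c :: "'a padic_int"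
  show "a * b * c = a * (b * c)"
    by transfer (simp add: fun_eq_iff mod_simps mult.assoc)
  show "a * b = b * a"
    by transfer (simp add: mult.commute)
  show "1 * a = a"
    by transfer (auto simp: fun_eq_iff mod_simps)
  show "a + b + c = a + (b + c)"
    by transfer (simp add: fun_eq_iff mod_simps add.assoc)
  show "a + b = b + a"
    by transfer (simp add: add.commute)
  show "0 + a = a"
    by transfer (auto simp: fun_eq_iff)
  show "- a + a = 0"
    by transfer (simp add: fun_eq_iff mod_simps)
  show "a - b = a + - b"
    by transfer (simp add: fun_eq_iff mod_simps)
  show "(a + b) * c = a * c + b * c"
    by transfer (simp add: fun_eq_iff mod_simps distrib_right)
  show "(0 :: 'a padic_int) \<noteq> 1"
  proof transfer
    have "(1::int) mod int CARD('a) ^ 1 = 1"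
      using prime_gt_1_nat[OF prime_card[where 'a = 'a]] by simp
    thus "(\<lambda>_. 0) \<noteq> (\<lambda>n. 1 mod int CARD('a) ^ n)"
      by (metis zero_neq_one)
  qed
qed

end

lemma padic_residue_mod:
  "m \<le> n \<Longrightarrow> padic_residue (x :: 'p :: prime_card padic_int) n mod int CARD('p) ^ m = padic_residue x m"
proof (induction n rule: dec_induct)
  case base
  show ?case using padic_residue[of x] by auto
next
  case (step n)
  have "padic_residue x (Suc n) mod int CARD('p) ^ m
      = padic_residue x (Suc n) mod int CARD('p) ^ n mod int CARD('p) ^ m"
    using step.hyps by (simp add: mod_mod_cancel le_imp_power_dvd)
  also have "\<dots> = padic_residue x n mod int CARD('p) ^ m"
    using padic_residue[of x] by simp
  finally show ?case using step.IH by simp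
qed

lemma padic_residue_of_nat:
  "padic_residue (of_nat k :: 'p :: prime_card padic_int) n = int k mod int CARD('p) ^ n"
  by (induction k)
    (simp_all add: zero_padic_int.rep_eq plus_padic_int.rep_eq one_padic_int.rep_eq mod_simps)

instance padic_int :: (prime_card) idom
proof
  fix a b :: "'a padic_int"
  let ?p = "int CARD('a)"
  assume "a \<noteq> 0" "b \<noteq> 0"
  then obtain m n where m: "padic_residue a m \<noteq> 0" and n: "padic_residue b n \<noteq> 0"
    by (metis padic_residue_inject zero_padic_int.rep_eq ext)
  have "padic_residue a 0 = 0"
    using padic_residue[of a] by (auto dest!: spec[of _ 0])
  hence "m \<noteq> 0"
    using m by metis
  have a: "\<not> ?p ^ m dvd padic_residue a (m + n)" and b: "\<not> ?p ^ n dvd padic_residue b (m + n)"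
    using m n padic_residue_mod[of m "m + n" a] padic_residue_mod[of n "m + n" b]
    by (auto simp: dvd_eq_mod_eq_0)
  show "a * b \<noteq> 0"
  proof
    assume "a * b = 0"
    hence "padic_residue (a * b) (m + n) = 0"
      by (simp add: zero_padic_int.rep_eq)
    hence "?p ^ (m + n) dvd padic_residue a (m + n) * padic_residue b (m + n)"
      by (simp add: times_padic_int.rep_eq dvd_eq_mod_eq_0)
    hence "?p ^ (m + n - 1) dvd padic_residue a (m + n) * padic_residue b (m + n)"
      by (rule power_le_dvd) simp
    moreover have "prime_elem ?p"
      using prime_card_int[where 'a = 'a] by (rule prime_imp_prime_elem)
    moreover have "m + n = Suc (m + n - 1)"
      using \<open>m \<noteq> 0\<close> by simp
    ultimately show False
      using a b prime_elem_power_dvd_cases by blast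
  qed
qed

instance padic_int :: (prime_card) ring_char_0
proof
  show "inj (of_nat :: nat \<Rightarrow> 'a padic_int)"
  proof (rule injI)
    fix k l :: nat
    assume eq: "(of_nat k :: 'a padic_int) = of_nat l"
    let ?n = "max k l"
    have "?n < CARD('a) ^ ?n"
      using prime_gt_1_nat[OF prime_card[where 'a = 'a]] by (intro power_gt_expt) simp
    hence kl: "k < CARD('a) ^ ?n" "l < CARD('a) ^ ?n"
      by linarith+
    have "int k mod int CARD('a) ^ ?n = int l mod int CARD('a) ^ ?n"
      using eq by (metis padic_residue_of_nat)
    hence "k mod CARD('a) ^ ?n = l mod CARD('a) ^ ?n"
      by (metis of_nat_power of_nat_mod of_nat_eq_iff)
    with kl show "k = l" by simp
  qed
qed

instance fract :: ("{idom, ring_char_0}") field_char_0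
proof
  have "(of_nat k :: 'a fract) = to_fract (of_nat k)" for k
    by (induction k) (simp_all add: to_fract_def One_fract_def Zero_fract_def)
  thus "inj (of_nat :: nat \<Rightarrow> 'a fract)"
    by (auto intro!: injI simp: to_fract_def eq_fract)
qed

text \<open>The field of \<open>p\<close>-adic numbers; \<open>to_fract\<close> is the inclusion of the \<open>p\<close>-adic integers.\<close>

type_synonym 'p padic = "'p padic_int fract"

text \<open>Congruence in \<open>\<int>\<^sub>p\<close>: the difference lies in \<open>m\<int>\<^sub>p\<close>.\<close>

definition padic_cong :: "'p :: prime_card padic \<Rightarrow> 'p padic \<Rightarrow> nat \<Rightarrow> bool" where
  "padic_cong a b m \<longleftrightarrow> (\<exists>z. a - b = of_nat m * to_fract z)"

definition least_residue :: "'p :: prime_card padic_int \<Rightarrow> nat" where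
  "least_residue x = (THE r. r < CARD('p) \<and> padic_cong (to_fract x) (of_nat r) CARD('p))"

lemma padic_residue_1_eq_0_iff:
  fixes x :: "'p :: prime_card padic_int"
  shows "padic_residue x 1 = 0 \<longleftrightarrow> (\<exists>z. x = of_nat CARD('p) * z)"
proof
  let ?p = "int CARD('p)"
  have p: "?p > 0" using card_pow_pos[of 1, where 'p = 'p] by simp
  assume x1: "padic_residue x 1 = 0"
  define f where "f n = padic_residue x (Suc n) div ?p" for n
  have dvd: "?p dvd padic_residue x (Suc n)" for n
    using padic_residue_mod[of 1 "Suc n" x] x1 by (simp add: dvd_eq_mod_eq_0)
  have f: "padic_residue x (Suc n) = ?p * f n" for n
    using dvd[of n] by (simp add: f_def)
  have rep: "padic_residue x n \<in> {0..<?p ^ n}"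
    "padic_residue x (Suc n) mod ?p ^ n = padic_residue x n" for n
    using padic_residue[of x] by auto
  have "f n \<in> {0..<?p ^ n}" for n
    using rep(1)[of "Suc n"] p by (auto simp: f zero_le_mult_iff)
  moreover have "f (Suc n) mod ?p ^ n = f n" for n
  proof -
    have "?p * (f (Suc n) mod ?p ^ n) = ?p * f n"
      using rep(2)[of "Suc n"] by (simp add: f)
    thus ?thesis using p by simp
  qed
  ultimately have "f \<in> {x. \<forall>n. x n \<in> {0..<?p ^ n} \<and> x (Suc n) mod ?p ^ n = x n}"
    by blast
  hence z: "padic_residue (Abs_padic_int f :: 'p padic_int) = f"
    by (rule Abs_padic_int_inverse)
  have "padic_residue (of_nat CARD('p) * Abs_padic_int f :: 'p padic_int) n = padic_residue x n" for n
    by (simp add: times_padic_int.rep_eq padic_residue_of_nat z mod_simps rep(2) flip: f)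
  thus "\<exists>z. x = of_nat CARD('p) * z"
    by (metis padic_residue_inject ext)
next
  assume "\<exists>z. x = of_nat CARD('p) * z"
  thus "padic_residue x 1 = 0"
    by (auto simp: times_padic_int.rep_eq padic_residue_of_nat)
qed

lemma to_fract_of_nat: "to_fract (of_nat k :: 'a :: idom) = of_nat k"
  by (induction k) simp_all

lemma padic_cong_of_nat_iff:
  fixes x :: "'p :: prime_card padic_int"
  assumes "r < CARD('p)"
  shows "padic_cong (to_fract x) (of_nat r) CARD('p) \<longleftrightarrow> padic_residue x 1 = int r"
proof -
  have "padic_cong (to_fract x) (of_nat r) CARD('p) \<longleftrightarrow> (\<exists>z. x - of_nat r = of_nat CARD('p) * z)"
    unfolding padic_cong_def
    by (simp only: to_fract_of_nat[symmetric] to_fract_diff[symmetric] to_fract_mult[symmetric]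
        to_fract_eq_iff)
  also have "\<dots> \<longleftrightarrow> (padic_residue x 1 - int r) mod int CARD('p) = 0"
    by (simp add: padic_residue_1_eq_0_iff[symmetric] minus_padic_int.rep_eq padic_residue_of_nat
        mod_simps)
  also have "\<dots> \<longleftrightarrow> padic_residue x 1 mod int CARD('p) = int r mod int CARD('p)"
    by (simp add: mod_eq_dvd_iff dvd_eq_mod_eq_0)
  also have "padic_residue x 1 mod int CARD('p) = padic_residue x 1"
    using padic_residue_mod[of 1 1 x] by simp
  finally show ?thesis
    using assms by simp
qed

lemma least_residue_eq:
  "least_residue (x :: 'p :: prime_card padic_int) = nat (padic_residue x 1)"
proof -
  have "padic_residue x 1 \<in> {0..<int CARD('p)}"
    using padic_residue[of x] by (auto dest: spec[of _ 1])
  then obtain r where r: "padic_residue x 1 = int r" "r < CARD('p)"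
    by (metis atLeastLessThan_iff nonneg_int_cases of_nat_less_iff)
  hence "least_residue x = r"
    unfolding least_residue_def
    by (intro the_equality) (use padic_cong_of_nat_iff[of _ x] in auto)
  with r show ?thesis by simp
qed

definition t_poly :: "nat \<Rightarrow> 'p :: prime_card padic_int \<Rightarrow> 'p padic" where
  "t_poly n x = (\<Sum>k\<le>n. of_nat (n choose k) * (to_fract x gchoose k)
                   * ((to_fract x + of_nat k) gchoose k) * 2 ^ k)"

end

theory Submission
  imports Defs "HOL-Computational_Algebra.Formal_Power_Series"
begin

text \<open>
  Write \<open>x = a + p y\<close> with \<open>a = \<langle>x\<rangle>\<^sub>p\<close> and let \<open>F x\<close> be the sum in question. Modulo \<open>p\<^sup>2\<close> it is affine
  in \<open>y\<close>, hence determined by \<open>F a\<close> and \<open>F (a - p)\<close>; since \<open>t\<^sub>n\<close> is invariant under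
  \<open>x \<mapsto> -1 - x\<close>, the latter equals \<open>F (p - 1 - a)\<close>.

  For an integer \<open>0 \<le> a < p\<close> let \<open>P v = \<Sum>\<^sub>k (a choose k) (a + k choose k) v\<^sup>k\<close> be the Legendre
  polynomial shifted to \<open>[-1, 0]\<close>. Then \<open>t\<^sub>n(a)\<close> is obtained from \<open>T w = P (2w)\<close> by replacing
  each power \<open>w\<^sup>k\<close> with \<open>n choose k\<close>. Under this correspondence multiplication by \<open>n + 1\<close>
  becomes \<open>f \<mapsto> (1 + w) (w f)'\<close>, and \<open>n \<mapsto> -1 - n\<close> becomes \<open>w \<mapsto> -1 - w\<close>. Because
  \<open>(k + l + 1) \<Sum>\<^sub>n\<^sub><\<^sub>p (n choose k) (n + l choose l) = p (p - 1 choose k) (p + l choose l)\<close>, the sum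
  \<open>F a\<close> is congruent modulo \<open>p\<^sup>2\<close> to \<open>p\<close> times the integral of \<open>(1 + w) (w T(w))' T(-1 - w)\<close>
  over \<open>[-1, 0]\<close>. Folding that interval at its midpoint and integrating by parts leaves \<open>1/4\<close>
  and the integral of \<open>P v\<close> against a polynomial of degree \<open>a + 1\<close>, which by Rodrigues' formula
  depends only on the two top coefficients of that polynomial.
\<close>

section \<open>Linear functionals on polynomials\<close>

definition moment_functional :: "(nat \<Rightarrow> 'a :: comm_ring_1) \<Rightarrow> 'a poly \<Rightarrow> 'a" where
  "moment_functional u p = (\<Sum>k\<le>degree p. coeff p k * u k)"

lemma moment_functional_altdef:
  "degree p \<le> n \<Longrightarrow> moment_functional u p = (\<Sum>k\<le>n. coeff p k * u k)"
  unfolding moment_functional_def by (intro sum.mono_neutral_left) (auto simp: coeff_eq_0)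

lemma moment_functional_0 [simp]: "moment_functional u 0 = 0"
  by (simp add: moment_functional_def)

lemma moment_functional_add:
  "moment_functional u (p + q) = moment_functional u p + moment_functional u q"
  using degree_add_le_max[of p q]
  by (simp add: moment_functional_altdef[of _ "max (degree p) (degree q)"] sum.distrib
      distrib_right)

lemma moment_functional_smult: "moment_functional u (smult c p) = c * moment_functional u p"
  by (simp add: moment_functional_altdef[of _ "degree p"] degree_smult_le sum_distrib_left mult_ac)

lemma moment_functional_diff:
  "moment_functional u (p - q) = moment_functional u p - moment_functional u q"
  using moment_functional_add[of u "p - q" q] by simp

lemma moment_functional_sum: "moment_functional u (sum f A) = (\<Sum>i\<in>A. moment_functional u (f i))"
  by (induction A rule: infinite_finite_induct) (simp_all add: moment_functional_add)

lemma moment_functional_monom: "moment_functional u (monom c n) = c * u n"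
  by (simp add: moment_functional_altdef[of _ n] degree_monom_le if_distrib[of "\<lambda>x. x * _"]
      cong: if_cong)

lemma moment_functional_pCons:
  "moment_functional u (pCons c p) = c * u 0 + moment_functional (\<lambda>k. u (Suc k)) p"
  by (simp add: moment_functional_altdef[of _ "Suc (degree p)"] degree_pCons_le
      sum.atMost_Suc_shift moment_functional_def del: sum.atMost_Suc)

lemma moment_functional_mult:
  "moment_functional u (p * q)
     = (\<Sum>k\<le>degree p. \<Sum>l\<le>degree q. coeff p k * coeff q l * u (k + l))"
proof -
  have "p * q = (\<Sum>k\<le>degree p. monom (coeff p k) k) * (\<Sum>l\<le>degree q. monom (coeff q l) l)"
    by (simp add: poly_as_sum_of_monoms)
  also have "\<dots> = (\<Sum>k\<le>degree p. \<Sum>l\<le>degree q. monom (coeff p k * coeff q l) (k + l))"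
    by (simp add: sum_product mult_monom)
  finally show ?thesis by (simp add: moment_functional_sum moment_functional_monom)
qed

lemma poly_conv_moment_functional: "poly p x = moment_functional (\<lambda>k. x ^ k) p"
  by (simp add: moment_functional_def poly_altdef)

lemma pcompose_conv_sum: "p \<circ>\<^sub>p q = (\<Sum>k\<le>degree p. smult (coeff p k) (q ^ k))"
proof -
  have "p \<circ>\<^sub>p q = (\<Sum>k\<le>degree p. smult (coeff p k) (monom 1 k)) \<circ>\<^sub>p q"
    by (simp add: smult_monom poly_as_sum_of_monoms)
  also have "monom 1 k \<circ>\<^sub>p q = q ^ k" for k
    by (induction k) (simp_all add: monom_Suc pcompose_pCons)
  hence "(\<Sum>k\<le>degree p. smult (coeff p k) (monom 1 k)) \<circ>\<^sub>p q
      = (\<Sum>k\<le>degree p. smult (coeff p k) (q ^ k))"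
    by (simp add: pcompose_sum pcompose_smult)
  finally show ?thesis .
qed

lemma moment_functional_pcompose:
  "moment_functional u (p \<circ>\<^sub>p q) = moment_functional (\<lambda>k. moment_functional u (q ^ k)) p"
  by (subst pcompose_conv_sum)
    (simp add: moment_functional_sum moment_functional_smult moment_functional_def[of _ p])

section \<open>Integration of polynomials\<close>

definition poly_integral :: "'a :: field_char_0 \<Rightarrow> 'a \<Rightarrow> 'a poly \<Rightarrow> 'a" where
  "poly_integral a b = moment_functional (\<lambda>k. (b ^ Suc k - a ^ Suc k) / of_nat (Suc k))"

lemma poly_integral_add: "poly_integral a b (p + q) = poly_integral a b p + poly_integral a b q"
  by (simp add: poly_integral_def moment_functional_add)

lemma poly_integral_diff: "poly_integral a b (p - q) = poly_integral a b p - poly_integral a b q"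
  by (simp add: poly_integral_def moment_functional_diff)

lemma poly_integral_minus: "poly_integral a b (- p) = - poly_integral a b p"
  using poly_integral_diff[of a b 0 p] by (simp add: poly_integral_def)

lemma poly_integral_smult: "poly_integral a b (smult c p) = c * poly_integral a b p"
  by (simp add: poly_integral_def moment_functional_smult)

lemma poly_integral_pderiv: "poly_integral a b (pderiv p) = poly p b - poly p a"
proof -
  have "poly_integral a b (pderiv p)
      = (\<Sum>k\<le>degree p. coeff p (Suc k) * (b ^ Suc k - a ^ Suc k))"
    unfolding poly_integral_def by (subst moment_functional_altdef[of _ "degree p"])
      (simp_all add: degree_pderiv coeff_pderiv mult.commute del: of_nat_Suc)
  moreover have "poly p x = coeff p 0 + (\<Sum>k\<le>degree p. coeff p (Suc k) * x ^ Suc k)" for x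
    unfolding poly_conv_moment_functional
    by (subst moment_functional_altdef[of _ "Suc (degree p)"])
      (simp_all only: le_Suc_eq sum.atMost_Suc_shift, simp_all)
  ultimately show ?thesis by (simp add: sum_subtractf right_diff_distrib)
qed

lemma antiderivative_exists:
  fixes p :: "'a :: field_char_0 poly"
  obtains q where "pderiv q = p"
proof
  show "pderiv (\<Sum>i\<le>degree p. monom (coeff p i / of_nat (Suc i)) (Suc i)) = p"
    by (simp add: pderiv_sum pderiv_monom poly_as_sum_of_monoms del: of_nat_Suc)
qed

lemma poly_integral_swap: "poly_integral b a p = - poly_integral a b p"
  by (metis antiderivative_exists minus_diff_eq poly_integral_pderiv)

lemma poly_integral_combine:
  "poly_integral a b p + poly_integral b c p = poly_integral a c p"
proof -
  obtain q where "pderiv q = p" by (rule antiderivative_exists)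
  thus ?thesis by (auto simp: poly_integral_pderiv)
qed

lemma poly_integral_substitution:
  "d * poly_integral a b (p \<circ>\<^sub>p [:c, d:]) = poly_integral (c + d * a) (c + d * b) p"
proof -
  obtain q where q: "pderiv q = p" by (rule antiderivative_exists)
  have "pderiv (q \<circ>\<^sub>p [:c, d:]) = smult d (p \<circ>\<^sub>p [:c, d:])"
    by (simp add: pderiv_pcompose q pderiv_pCons)
  hence "d * poly_integral a b (p \<circ>\<^sub>p [:c, d:]) = poly_integral a b (pderiv (q \<circ>\<^sub>p [:c, d:]))"
    by (simp add: poly_integral_smult)
  also have "\<dots> = poly q (c + d * b) - poly q (c + d * a)"
    by (simp add: poly_integral_pderiv poly_pcompose mult.commute)
  finally show ?thesis by (simp add: poly_integral_pderiv flip: q)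
qed

lemma poly_integral_reflection:
  "poly_integral a b (p \<circ>\<^sub>p [:c, - 1:]) = poly_integral (c - b) (c - a) p"
  using poly_integral_substitution[of "- 1" a b p c] by (simp add: poly_integral_swap[of "c - a"])

lemma poly_integral_by_parts:
  "poly_integral a b (p * pderiv q)
     = poly p b * poly q b - poly p a * poly q a - poly_integral a b (pderiv p * q)"
  using poly_integral_pderiv[of a b "p * q"]
  by (simp add: pderiv_mult poly_integral_add mult.commute eq_diff_eq)

lemma higher_pderiv_pcompose_linear:
  "(pderiv ^^ n) (p \<circ>\<^sub>p [:c, d:]) = smult (d ^ n) ((pderiv ^^ n) p \<circ>\<^sub>p [:c, d:])"
  by (induction n) (simp_all add: pderiv_smult pderiv_pcompose pderiv_pCons mult.commute)

lemma higher_pderiv_degree_le_Suc: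
  fixes q :: "'a :: field_char_0 poly"
  assumes "degree q \<le> Suc n"
  shows "(pderiv ^^ n) q = smult (fact n) [:coeff q n, of_nat (Suc n) * coeff q (Suc n):]"
proof (rule poly_eqI)
  fix k
  have "pochhammer 2 n = of_nat (Suc n) * (fact n :: 'a)"
    using pochhammer_rec[of "1 :: 'a" n] fact_Suc[of n] pochhammer_fact[of "Suc n", where 'a = 'a]
    by simp
  moreover have "coeff q (Suc (Suc (k + n))) = 0" for k
    using assms by (intro coeff_eq_0) simp
  ultimately show "coeff ((pderiv ^^ n) q) k
      = coeff (smult (fact n) [:coeff q n, of_nat (Suc n) * coeff q (Suc n):]) k"
    by (auto simp: coeff_higher_pderiv coeff_pCons pochhammer_fact split: nat.split)
qed

lemma power_dvd_higher_pderiv_power: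
  fixes p :: "'a :: idom poly"
  shows "j \<le> n \<Longrightarrow> p ^ (n - j) dvd (pderiv ^^ j) (p ^ n)"
proof (induction j)
  case (Suc j)
  have "n - j = Suc (n - Suc j)" using Suc.prems by simp
  hence "p ^ Suc (n - Suc j) dvd (pderiv ^^ j) (p ^ n)"
    using Suc.IH Suc.prems by (metis Suc_leD)
  then obtain r where "(pderiv ^^ j) (p ^ n) = p ^ Suc (n - Suc j) * r" by (elim dvdE)
  thus ?case
    by (simp add: pderiv_mult pderiv_power_Suc del: power_Suc)
      (auto simp: algebra_simps intro!: dvd_add dvd_smult dvd_mult)
qed simp

lemma poly_higher_pderiv_power_eq_0:
  fixes p :: "'a :: idom poly"
  assumes "poly p x = 0" "j < n"
  shows "poly ((pderiv ^^ j) (p ^ n)) x = 0"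
proof -
  have "p ^ (n - j) dvd (pderiv ^^ j) (p ^ n)"
    using assms(2) by (intro power_dvd_higher_pderiv_power) simp
  then obtain r where "(pderiv ^^ j) (p ^ n) = p ^ (n - j) * r" by (elim dvdE)
  thus ?thesis using assms by (simp add: power_0_left)
qed

lemma poly_integral_higher_pderiv_by_parts:
  assumes "\<And>j. j < n \<Longrightarrow> poly ((pderiv ^^ j) r) a = 0"
    and "\<And>j. j < n \<Longrightarrow> poly ((pderiv ^^ j) r) b = 0"
  shows "poly_integral a b (q * (pderiv ^^ n) r)
     = (- 1) ^ n * poly_integral a b ((pderiv ^^ n) q * r)"
  using assms
proof (induction n arbitrary: q)
  case (Suc n)
  have "poly_integral a b (q * (pderiv ^^ Suc n) r)
      = - poly_integral a b (pderiv q * (pderiv ^^ n) r)"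
    using Suc.prems by (simp add: poly_integral_by_parts)
  also have "\<dots> = - ((- 1) ^ n * poly_integral a b ((pderiv ^^ n) (pderiv q) * r))"
    using Suc.prems by (simp add: Suc.IH)
  finally show ?case by (simp add: funpow_swap1)
qed simp

lemma poly_integral_pderiv_mult_reflection:
  assumes "s = 2 * m"
  shows "poly_integral (s - b) b (pderiv p * (p \<circ>\<^sub>p [:s, - 1:]))
     = poly p b * poly p (s - b) - poly p m ^ 2
         - 2 * poly_integral m b (p * pderiv (p \<circ>\<^sub>p [:s, - 1:]))"
proof -
  define r where "r = p \<circ>\<^sub>p [:s, - 1:]"
  have r: "pderiv p \<circ>\<^sub>p [:s, - 1:] = - pderiv r" "r \<circ>\<^sub>p [:s, - 1:] = p"
    by (simp_all add: r_def pderiv_pcompose pderiv_pCons pcompose_pCons flip: pcompose_assoc)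
  have "poly_integral (s - b) m (pderiv p * r) = poly_integral m b ((pderiv p * r) \<circ>\<^sub>p [:s, - 1:])"
    by (simp add: poly_integral_reflection assms)
  also have "(pderiv p * r) \<circ>\<^sub>p [:s, - 1:] = - (p * pderiv r)"
    by (simp add: pcompose_mult r)
  finally have "poly_integral (s - b) b (pderiv p * r)
      = poly_integral m b (pderiv p * r) - poly_integral m b (p * pderiv r)"
    by (simp add: poly_integral_minus flip: poly_integral_combine[of "s - b" m _ b])
  moreover have "poly r b = poly p (s - b)" "poly r m = poly p m"
    by (simp_all add: r_def poly_pcompose assms)
  ultimately show ?thesis
    using poly_integral_by_parts[of m b p r] by (simp add: power2_eq_square flip: r_def)
qed

section \<open>Shifted Legendre polynomials\<close>

definition shifted_legendre :: "nat \<Rightarrow> 'a :: field_char_0 poly" where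
  "shifted_legendre a = (\<Sum>k\<le>a. monom (of_nat ((a choose k) * (a + k choose k))) k)"

lemma coeff_shifted_legendre:
  "coeff (shifted_legendre a) k = of_nat ((a choose k) * (a + k choose k))"
  by (simp add: shifted_legendre_def coeff_sum)

lemma degree_shifted_legendre [simp]: "degree (shifted_legendre a) = a"
proof (rule antisym)
  show "degree (shifted_legendre a) \<le> a"
    by (rule degree_le) (simp add: coeff_shifted_legendre)
  show "a \<le> degree (shifted_legendre a)"
    by (rule le_degree) (simp add: coeff_shifted_legendre)
qed

lemma shifted_legendre_Rodrigues:
  "smult (fact a) (shifted_legendre a) = (pderiv ^^ a) ([:0, 1, 1:] ^ a)"
proof (rule poly_eqI)
  fix k
  have "[:0, 1, 1 :: 'a:] ^ a = monom 1 a * [:1, 1:] ^ a"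
    by (simp add: monom_altdef flip: power_mult_distrib)
  hence "coeff ([:0, 1, 1 :: 'a:] ^ a) (k + a) = of_nat (a choose k)"
    by (cases "k \<le> a")
      (simp_all add: coeff_monom_mult coeff_linear_poly_power coeff_eq_0 degree_linear_power)
  moreover have "fact a * of_nat (a + k choose k) = (pochhammer (of_nat (Suc k)) a :: 'a)"
    using pochhammer_product'[of "1 :: 'a" k a]
    by (simp add: binomial_fact add_ac field_simps flip: pochhammer_fact)
  ultimately show "coeff (smult (fact a) (shifted_legendre a)) k
      = coeff ((pderiv ^^ a) ([:0, 1, 1 :: 'a:] ^ a)) k"
    by (simp add: coeff_shifted_legendre coeff_higher_pderiv mult.left_commute)
qed

lemma shifted_legendre_reflect:
  "shifted_legendre a \<circ>\<^sub>p [:- 1, - 1:]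
     = smult ((- 1) ^ a) (shifted_legendre a :: 'a :: field_char_0 poly)"
proof -
  have "[:0, 1, 1:] ^ a \<circ>\<^sub>p [:- 1, - 1:] = ([:0, 1, 1:] ^ a :: 'a poly)"
    by (simp add: pcompose_hom.hom_power pcompose_pCons)
  hence "smult ((- 1) ^ a) ((pderiv ^^ a) ([:0, 1, 1 :: 'a:] ^ a) \<circ>\<^sub>p [:- 1, - 1:])
      = (pderiv ^^ a) ([:0, 1, 1:] ^ a)"
    by (metis higher_pderiv_pcompose_linear)
  hence "smult (fact a) (smult ((- 1) ^ a) (shifted_legendre a \<circ>\<^sub>p [:- 1, - 1 :: 'a:]))
      = smult (fact a) (shifted_legendre a)"
    by (simp add: pcompose_smult mult.commute flip: shifted_legendre_Rodrigues)
  from arg_cong[OF this, of "smult ((- 1) ^ a / fact a)"] show ?thesis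
    by (simp flip: power_mult_distrib)
qed

lemma poly_shifted_legendre_0 [simp]: "poly (shifted_legendre a) 0 = 1"
  by (simp add: poly_0_coeff_0 coeff_shifted_legendre)

lemma poly_shifted_legendre_minus_1 [simp]: "poly (shifted_legendre a) (- 1) = (- 1) ^ a"
  using arg_cong[OF shifted_legendre_reflect[of a], of "\<lambda>p. poly p 0"] by (simp add: poly_pcompose)

lemma poly_integral_mult_shifted_legendre_by_parts:
  "fact a * poly_integral (- 1) 0 (q * shifted_legendre a)
     = (- 1) ^ a * poly_integral (- 1) 0 ((pderiv ^^ a) q * [:0, 1, 1:] ^ a)"
proof -
  have "fact a * poly_integral (- 1) 0 (q * shifted_legendre a)
      = poly_integral (- 1) 0 (q * (pderiv ^^ a) ([:0, 1, 1:] ^ a))"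
    by (simp add: poly_integral_smult flip: shifted_legendre_Rodrigues)
  thus ?thesis
    by (simp add: poly_integral_higher_pderiv_by_parts poly_higher_pderiv_power_eq_0)
qed

definition rodrigues_integral :: "nat \<Rightarrow> 'a :: field_char_0" where
  "rodrigues_integral a = (- 1) ^ a * poly_integral (- 1) 0 ([:0, 1, 1:] ^ a)"

lemma poly_integral_linear_mult_rodrigues_weight:
  "poly_integral (- 1) 0 ([:c, d:] * [:0, 1, 1:] ^ a)
     = (c - d / 2) * poly_integral (- 1) 0 ([:0, 1, 1 :: 'a :: field_char_0:] ^ a)"
proof -
  define w where "w = ([:0, 1, 1 :: 'a:] ^ a)"
  define xw where "xw = [:0, 1:] * w"
  have "w \<circ>\<^sub>p [:- 1, - 1:] = w"
    by (simp add: w_def pcompose_hom.hom_power pcompose_pCons)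
  hence "xw \<circ>\<^sub>p [:- 1, - 1:] = - (w + xw)"
    by (simp add: xw_def pcompose_pCons)
  hence "poly_integral (- 1) 0 xw = - (poly_integral (- 1) 0 w + poly_integral (- 1) 0 xw)"
    using poly_integral_reflection[of "- 1" 0 xw "- 1"]
    by (simp add: poly_integral_minus poly_integral_diff)
  hence "poly_integral (- 1) 0 xw = - poly_integral (- 1) 0 w / 2"
    by (simp add: field_simps)
  moreover have "[:c, d:] * w = smult c w + smult d xw"
    by (simp add: xw_def)
  ultimately show ?thesis
    by (simp add: poly_integral_smult poly_integral_add algebra_simps flip: w_def)
qed

lemma poly_integral_mult_shifted_legendre:
  fixes q :: "'a :: field_char_0 poly"
  assumes "degree q \<le> Suc a"
  shows "poly_integral (- 1) 0 (q * shifted_legendre a)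
     = (coeff q a - of_nat (Suc a) * coeff q (Suc a) / 2) * rodrigues_integral a"
proof -
  have "fact a * poly_integral (- 1) 0 (q * shifted_legendre a)
      = fact a * ((coeff q a - of_nat (Suc a) * coeff q (Suc a) / 2) * rodrigues_integral a)"
    unfolding poly_integral_mult_shifted_legendre_by_parts higher_pderiv_degree_le_Suc[OF assms]
      mult_smult_left poly_integral_smult poly_integral_linear_mult_rodrigues_weight
      rodrigues_integral_def
    by (simp only: mult_ac)
  thus ?thesis by simp
qed

lemma coeff_mult_rodrigues_integral:
  "coeff (shifted_legendre a) a * rodrigues_integral a
     = 1 / (of_nat (2 * a + 1) :: 'a :: field_char_0)"
proof -
  define P where "P = (shifted_legendre a :: 'a poly)"
  have deg: "degree P \<le> Suc a" "degree ([:0, 1:] * pderiv P) \<le> Suc a"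
    by (simp_all add: P_def degree_pderiv degree_pCons_le)
  have coeffs: "coeff P (Suc a) = 0" "coeff ([:0, 1:] * pderiv P) (Suc a) = 0"
    "coeff ([:0, 1:] * pderiv P) a = of_nat a * coeff P a"
    by (simp_all add: P_def coeff_pderiv coeff_shifted_legendre)
      (cases a; simp add: coeff_pderiv coeff_shifted_legendre)
  have "1 = poly_integral (- 1) 0 (pderiv ([:0, 1:] * (P * P)))"
    unfolding poly_integral_pderiv by (simp add: P_def flip: power_mult_distrib)
  also have "pderiv ([:0, 1:] * (P * P)) = P * P + smult 2 ([:0, 1:] * pderiv P * P)"
    by (simp add: pderiv_pCons pderiv_mult mult.commute numeral_poly)
  also have "poly_integral (- 1) 0 \<dots> = (coeff P a * rodrigues_integral a) * of_nat (2 * a + 1)"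
    unfolding poly_integral_add poly_integral_smult
      poly_integral_mult_shifted_legendre[OF deg(1), folded P_def]
      poly_integral_mult_shifted_legendre[OF deg(2), folded P_def]
      coeffs
    by (simp add: algebra_simps)
  finally show ?thesis
    using of_nat_neq_0[of "2 * a", where 'a = 'a] by (simp add: P_def eq_divide_eq)
qed


lemma coeff_pcompose_shift:
  fixes p :: "'a :: comm_semiring_1 poly"
  assumes "degree p \<le> Suc n"
  shows "coeff (p \<circ>\<^sub>p [:1, 1:]) n = coeff p n + of_nat (Suc n) * coeff p (Suc n)"
proof -
  have "coeff ([:1, 1 :: 'a:] ^ i) n = of_nat (i choose n)" for i
    by (cases "n \<le> i")
      (simp_all add: coeff_linear_poly_power coeff_eq_0 degree_linear_power binomial_eq_0)
  hence "coeff (p \<circ>\<^sub>p [:1, 1:]) n = (\<Sum>i\<le>degree p. coeff p i * of_nat (i choose n))"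
    by (simp add: pcompose_conv_sum coeff_sum)
  also have "\<dots> = (\<Sum>i\<le>Suc n. coeff p i * of_nat (i choose n))"
    using assms by (intro sum.mono_neutral_left) (auto simp: coeff_eq_0)
  also have "\<dots> = (\<Sum>i\<in>{n, Suc n}. coeff p i * of_nat (i choose n))"
    by (intro sum.mono_neutral_right) (auto simp: binomial_eq_0)
  finally show ?thesis by (simp add: mult.commute)
qed

lemma coeff_shifted_legendre_pred:
  "2 * coeff (shifted_legendre (Suc b)) b
     = (of_nat (Suc b) * coeff (shifted_legendre (Suc b)) (Suc b) :: 'a :: field_char_0)"
proof -
  have "(2 * b + 2 choose Suc b) = 2 * (2 * b + 1 choose b)"
    using binomial_symmetric[of b "2 * b + 1"] by simp
  hence "2 * ((Suc b choose b) * (Suc b + b choose b))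
      = Suc b * ((Suc b choose Suc b) * (Suc b + Suc b choose Suc b))"
    by (simp add: mult_2 distrib_left)
  from arg_cong[OF this, of "of_nat :: nat \<Rightarrow> 'a"] show ?thesis
    by (simp only: coeff_shifted_legendre of_nat_mult of_nat_numeral)
qed

lemma coeff_shifted_legendre_shift_pred:
  "2 * coeff (shifted_legendre (Suc b) \<circ>\<^sub>p [:1, 1:]) b
     = (3 * of_nat (Suc b) * coeff (shifted_legendre (Suc b)) (Suc b) :: 'a :: field_char_0)"
  using coeff_shifted_legendre_pred[of b, where 'a = 'a]
  by (simp add: coeff_pcompose_shift distrib_left)

lemma poly_integral_shifted_legendre_mult_shift:
  fixes a :: nat
  defines "P \<equiv> shifted_legendre a :: 'a :: field_char_0 poly"
  shows "2 * poly_integral (- 1) 0 ([:0, 1:] * P * pderiv ([:2, 1:] * (P \<circ>\<^sub>p [:1, 1:])))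
     = (2 * of_nat a ^ 2 + 2 * of_nat a - 1) / of_nat (2 * a + 1)"
proof -
  define P1 where "P1 = P \<circ>\<^sub>p [:1, 1:]"
  define q where "q = [:0, 1:] * pderiv ([:2, 1:] * P1)"
  have deg: "degree P = a" "degree P1 = a"
    by (simp_all add: P_def P1_def degree_pcompose)
  have P1_a: "coeff P1 a = coeff P a"
    by (simp add: P1_def coeff_pcompose_shift deg coeff_eq_0)
  have "degree q \<le> Suc a"
    using degree_mult_le[of "[:0, 1:]" "pderiv ([:2, 1:] * P1)"] degree_mult_le[of "[:2, 1:]" P1]
    by (simp add: q_def degree_pderiv deg)
  have q_Suc: "coeff q (Suc a) = of_nat (Suc a) * coeff P a"
    by (simp add: q_def coeff_pderiv P1_a coeff_eq_0 deg)
  have q_a: "2 * coeff q a = of_nat a * (3 * of_nat a + 4) * coeff P a"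
  proof (cases a)
    case (Suc b)
    have "2 * coeff P1 b = 3 * of_nat a * coeff P a"
      unfolding P1_def P_def Suc by (rule coeff_shifted_legendre_shift_pred)
    moreover have "coeff q a = of_nat a * (2 * coeff P1 a + coeff P1 b)"
      by (simp add: q_def coeff_pderiv Suc)
    ultimately have "2 * coeff q a = of_nat a * (4 * coeff P a + 3 * of_nat a * coeff P a)"
      by (simp add: P1_a)
    thus ?thesis by (simp add: algebra_simps)
  qed (simp add: q_def)
  have "2 * poly_integral (- 1) 0 (q * P)
      = (2 * coeff q a - of_nat (Suc a) * coeff q (Suc a)) * rodrigues_integral a"
    unfolding P_def poly_integral_mult_shifted_legendre[OF \<open>degree q \<le> Suc a\<close>]
    by (simp add: left_diff_distrib right_diff_distrib)
  also have "\<dots> = (2 * of_nat a ^ 2 + 2 * of_nat a - 1) * (coeff P a * rodrigues_integral a)"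
    unfolding q_a q_Suc by (simp add: algebra_simps power2_eq_square)
  also have "coeff P a * rodrigues_integral a = 1 / of_nat (2 * a + 1)"
    unfolding P_def by (rule coeff_mult_rodrigues_integral)
  also have "q * P = [:0, 1:] * P * pderiv ([:2, 1:] * P1)"
    by (simp only: q_def mult_ac)
  finally show ?thesis unfolding P1_def by (simp only: times_divide_eq_right mult_1_right)
qed

section \<open>Newton series\<close>

definition newton_eval :: "'a :: field_char_0 poly \<Rightarrow> 'a \<Rightarrow> 'a" where
  "newton_eval p x = moment_functional (\<lambda>k. x gchoose k) p"

lemma newton_eval_shift_power: "newton_eval ([:1, 1:] ^ k) x = (x + of_nat k) gchoose k"
proof -
  have "newton_eval ([:1, 1:] ^ k) x = (\<Sum>j\<le>k. of_nat (k choose j) * (x gchoose j))"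
    unfolding newton_eval_def
    by (subst moment_functional_altdef[of _ k])
      (simp_all add: degree_linear_power coeff_linear_poly_power)
  also have "\<dots> = (\<Sum>j=0..k. (x gchoose j) * (of_nat k gchoose (k - j)))"
    by (intro sum.cong)
      (simp_all add: atLeast0AtMost binomial_gbinomial mult.commute
        flip: gbinomial_of_nat_symmetric)
  finally show ?thesis by (simp only: gbinomial_Vandermonde)
qed

lemma newton_eval_reflect: "newton_eval (p \<circ>\<^sub>p [:- 1, - 1:]) (- 1 - x) = newton_eval p x"
proof -
  have "newton_eval ([:- 1, - 1:] ^ k) (- 1 - x) = x gchoose k" for k
  proof -
    have "[:- 1, - 1 :: 'a:] = smult (- 1) [:1, 1:]" by simp
    hence "newton_eval ([:- 1, - 1:] ^ k) (- 1 - x)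
        = (- 1) ^ k * newton_eval ([:1, 1:] ^ k) (- 1 - x)"
      by (simp only: smult_power newton_eval_def moment_functional_smult)
    also have "\<dots> = (- 1) ^ k * ((of_nat k - x - 1) gchoose k)"
      by (simp add: newton_eval_shift_power algebra_simps)
    finally show ?thesis by (simp only: gbinomial_negated_upper[of x])
  qed
  thus ?thesis by (simp add: newton_eval_def moment_functional_pcompose)
qed

lemma newton_eval_mult_Suc:
  "newton_eval ([:1, 1:] * pderiv ([:0, 1:] * p)) x = (x + 1) * newton_eval p x"
proof -
  have shift: "moment_functional u ([:1, 1:] * q) = moment_functional (\<lambda>k. u k + u (Suc k)) q"
    for u and q :: "'a poly"
    by (simp add: moment_functional_add moment_functional_pCons)
      (simp add: moment_functional_def sum.distrib distrib_left)
  have scale: "moment_functional u (pderiv ([:0, 1:] * p))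
      = moment_functional (\<lambda>k. of_nat (Suc k) * u k) p" for u
    by (subst (1 2) moment_functional_altdef[of _ "degree p"])
      (simp_all add: degree_pderiv degree_pCons_le coeff_pderiv mult_ac del: of_nat_Suc)
  have "of_nat (Suc k) * ((x gchoose k) + (x gchoose Suc k)) = (x + 1) * (x gchoose k)" for k
    by (simp only: Suc_times_gbinomial flip: gbinomial_Suc_Suc)
  thus ?thesis
    unfolding newton_eval_def shift scale
    by (simp only: moment_functional_def sum_distrib_left mult.left_commute)
qed

lemma gbinomial_minus_Suc_of_nat:
  "(- 1 - of_nat n :: 'a :: field_char_0) gchoose l = (- 1) ^ l * of_nat (n + l choose l)"
  using gbinomial_minus[of "of_nat (Suc n) :: 'a" l]
  by (simp add: binomial_gbinomial algebra_simps)

lemma sum_newton_eval_mult: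
  "(\<Sum>n<N. newton_eval f (of_nat n) * newton_eval g (- 1 - of_nat n))
     = (\<Sum>k\<le>degree f. \<Sum>l\<le>degree g. coeff f k * coeff g l
          * ((- 1) ^ l * of_nat (\<Sum>n<N. (n choose k) * (n + l choose l))))"
proof -
  have "(\<Sum>n<N. newton_eval f (of_nat n) * newton_eval g (- 1 - of_nat n))
      = (\<Sum>n<N. \<Sum>k\<le>degree f. \<Sum>l\<le>degree g. coeff f k * coeff g l
          * ((- 1) ^ l * of_nat ((n choose k) * (n + l choose l))))"
    unfolding newton_eval_def moment_functional_def gbinomial_minus_Suc_of_nat sum_product
      binomial_gbinomial[symmetric]
    by (simp only: mult_ac of_nat_mult)
  also have "\<dots> = (\<Sum>k\<le>degree f. \<Sum>l\<le>degree g. \<Sum>n<N. coeff f k * coeff g l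
          * ((- 1) ^ l * of_nat ((n choose k) * (n + l choose l))))"
    by (subst sum.swap, intro sum.cong refl sum.swap)
  finally show ?thesis by (simp only: of_nat_sum sum_distrib_left)
qed

lemma sum_binomial_product:
  "(k + l + 1) * (\<Sum>n<N. (n choose k) * (n + l choose l)) = N * (N - 1 choose k) * (N + l choose l)"
proof -
  have "(k + l + 1) * (\<Sum>n<N. (n choose k) * (n + l choose l))
      = (N - k) * (N choose k) * (N + l choose l)"
  proof (induction N)
    case (Suc N)
    have upper: "(Suc N - k) * (Suc N choose k) = Suc N * (N choose k)"
      using binomial_absorb_comp[of "Suc N" k] by simp
    have lower: "Suc N * (Suc N + l choose l) = (N + l + 1) * (N + l choose l)"
      using binomial_absorb_comp[of "Suc N + l" l] by simp
    have weight: "((N - k) + (k + l + 1)) * (N choose k) = (N + l + 1) * (N choose k)"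
      by (cases "k \<le> N") (simp_all add: binomial_eq_0)
    have "(k + l + 1) * (\<Sum>n<Suc N. (n choose k) * (n + l choose l))
        = (((N - k) + (k + l + 1)) * (N choose k)) * (N + l choose l)"
      unfolding sum.lessThan_Suc distrib_left Suc.IH
      by (simp only: distrib_right distrib_left mult_ac)
    also have "\<dots> = (Suc N * (Suc N + l choose l)) * (N choose k)"
      unfolding weight lower by (simp only: mult_ac)
    also have "\<dots> = (Suc N - k) * (Suc N choose k) * (Suc N + l choose l)"
      unfolding upper by (simp only: mult_ac)
    finally show ?case .
  qed simp
  thus ?thesis unfolding binomial_absorb_comp .
qed

lemma sum_binomial_product_complementary:
  assumes "N = Suc (k + l)"
  shows "(\<Sum>n<N. (n choose k) * (n + l choose l)) = (N - 1 choose l) * (N + l choose l)"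
proof -
  have "(N - 1 choose k) = (N - 1 choose l)"
    using binomial_symmetric[of k "k + l"] by (simp add: assms)
  hence "N * (\<Sum>n<N. (n choose k) * (n + l choose l)) = N * ((N - 1 choose l) * (N + l choose l))"
    using sum_binomial_product[of k l N] assms by (simp only: Suc_eq_plus1 mult.assoc)
  thus ?thesis by (metis assms mult_cancel1 Zero_not_Suc)
qed

section \<open>The polynomials \<open>t\<^sub>n\<close> at natural numbers\<close>

definition gen_t_poly :: "nat \<Rightarrow> 'a :: field_char_0 \<Rightarrow> 'a" where
  "gen_t_poly n x
     = (\<Sum>k\<le>n. of_nat (n choose k) * (x gchoose k) * ((x + of_nat k) gchoose k) * 2 ^ k)"

lemma gen_t_poly_reflect: "gen_t_poly n (- 1 - x) = gen_t_poly n x"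
proof -
  have "((- 1 - x) gchoose k) * ((- 1 - x + of_nat k) gchoose k)
      = (x gchoose k) * ((x + of_nat k) gchoose k)" for k
    using gbinomial_negated_upper[of "- 1 - x" k] gbinomial_negated_upper[of "- 1 - x + of_nat k" k]
    by (simp add: algebra_simps flip: power_mult_distrib)
  thus ?thesis by (simp add: gen_t_poly_def mult.assoc)
qed

definition t_newton_poly :: "nat \<Rightarrow> 'a :: field_char_0 poly" where
  "t_newton_poly a = shifted_legendre a \<circ>\<^sub>p [:0, 2:]"

lemma coeff_t_newton_poly:
  "coeff (t_newton_poly a) k = 2 ^ k * of_nat ((a choose k) * (a + k choose k))"
  by (simp add: t_newton_poly_def coeff_pcompose_linear coeff_shifted_legendre)

lemma degree_t_newton_poly [simp]: "degree (t_newton_poly a) = a"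
  by (simp add: t_newton_poly_def degree_pcompose)

definition weighted_t_newton_poly :: "nat \<Rightarrow> 'a :: field_char_0 poly" where
  "weighted_t_newton_poly a = [:1, 1:] * pderiv ([:0, 1:] * t_newton_poly a)"

lemma coeff_weighted_t_newton_poly:
  "coeff (weighted_t_newton_poly a) k
     = of_nat (Suc k) * coeff (t_newton_poly a) k
       + (if k = 0 then 0 else of_nat k * coeff (t_newton_poly a) (k - 1))"
  by (cases k) (simp_all add: weighted_t_newton_poly_def coeff_pderiv)

lemma degree_weighted_t_newton_poly: "degree (weighted_t_newton_poly a) \<le> Suc a"
  by (rule degree_le) (auto simp: coeff_weighted_t_newton_poly coeff_eq_0)

lemma newton_eval_t_newton_poly:
  "newton_eval (t_newton_poly a) (of_nat n) = gen_t_poly n (of_nat a)"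
proof -
  have "newton_eval (t_newton_poly a) (of_nat n)
      = (\<Sum>k\<le>max a n. of_nat (n choose k) * of_nat (a choose k) * of_nat (a + k choose k) * 2 ^ k)"
    unfolding newton_eval_def
    by (subst moment_functional_altdef[of _ "max a n"])
      (simp_all add: coeff_t_newton_poly mult_ac flip: binomial_gbinomial)
  also have "\<dots>
      = (\<Sum>k\<le>n. of_nat (n choose k) * of_nat (a choose k) * of_nat (a + k choose k) * 2 ^ k)"
    by (intro sum.mono_neutral_right) (auto simp: binomial_eq_0)
  finally show ?thesis
    by (simp add: gen_t_poly_def flip: binomial_gbinomial of_nat_add)
qed

definition legendre_ratio :: "'a :: field_char_0 \<Rightarrow> 'a" where
  "legendre_ratio x = (2 * x ^ 2 + 2 * x - 1) / (4 * (2 * x + 1))"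

lemma legendre_ratio_altdef: "legendre_ratio x = ((2 * x + 1) - 3 / (2 * x + 1)) / 8"
proof -
  define s where "s = 2 * x + 1"
  have "2 * x ^ 2 + 2 * x - 1 = (s ^ 2 - 3) / 2"
    by (simp add: s_def power2_eq_square field_simps)
  hence "legendre_ratio x = (s ^ 2 - 3) / 2 / (4 * s)"
    by (simp only: legendre_ratio_def s_def[symmetric])
  also have "\<dots> = (s - 3 / s) / 8"
    by (cases "s = 0") (simp_all add: power2_eq_square field_simps)
  finally show ?thesis unfolding s_def .
qed

lemma legendre_ratio_reflect: "legendre_ratio (- 1 - x) = - legendre_ratio x"
proof -
  have "2 * (- 1 - x) + 1 = - (2 * x + 1)" by simp
  moreover have "(- s - 3 / - s) / 8 = - ((s - 3 / s) / 8)" for s :: 'a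
    by (simp add: diff_divide_distrib)
  ultimately show ?thesis by (simp only: legendre_ratio_altdef)
qed

lemma poly_integral_half_t_newton_poly:
  fixes a :: nat
  defines "A \<equiv> [:0, 1:] * t_newton_poly a :: 'a :: field_char_0 poly"
  shows "2 * poly_integral (- 1 / 2) 0 (A * pderiv (A \<circ>\<^sub>p [:- 1, - 1:]))
     = - ((- 1) ^ a * legendre_ratio (of_nat a))"
proof -
  define P where "P = (shifted_legendre a :: 'a poly)"
  define B where "B = [:2, 1:] * (P \<circ>\<^sub>p [:1, 1:])"
  define e where "e = (- 1 :: 'a) ^ a"
  have A_scaled: "A \<circ>\<^sub>p [:0, 1 / 2:] = smult (1 / 2) ([:0, 1:] * P)"
    by (simp add: A_def t_newton_poly_def P_def pcompose_mult pcompose_pCons flip: pcompose_assoc)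
  have "P \<circ>\<^sub>p [:- 2, - 1:] = (P \<circ>\<^sub>p [:- 1, - 1:]) \<circ>\<^sub>p [:1, 1:]"
    by (simp add: pcompose_pCons flip: pcompose_assoc)
  also have "\<dots> = smult e (P \<circ>\<^sub>p [:1, 1:])"
    by (simp add: P_def e_def shifted_legendre_reflect pcompose_smult)
  finally have P_reflected: "P \<circ>\<^sub>p [:- 2, - 1:] = smult e (P \<circ>\<^sub>p [:1, 1:])" .
  have "A \<circ>\<^sub>p [:- 1, - 1:] \<circ>\<^sub>p [:0, 1 / 2:] = A \<circ>\<^sub>p [:- 1, - 1 / 2:]"
    by (simp add: pcompose_pCons flip: pcompose_assoc)
  also have "\<dots> = [:- 1, - 1 / 2:] * (P \<circ>\<^sub>p [:- 2, - 1:])"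
    by (simp add: A_def t_newton_poly_def P_def pcompose_mult pcompose_pCons flip: pcompose_assoc)
  also have "\<dots> = smult (- e / 2) B"
    by (simp add: P_reflected B_def smult_add_right smult_diff_right)
  finally have A_reflected: "A \<circ>\<^sub>p [:- 1, - 1:] \<circ>\<^sub>p [:0, 1 / 2:] = smult (- e / 2) B" .
  have "pderiv (A \<circ>\<^sub>p [:- 1, - 1:]) \<circ>\<^sub>p [:0, 1 / 2:]
      = smult 2 (pderiv (A \<circ>\<^sub>p [:- 1, - 1:] \<circ>\<^sub>p [:0, 1 / 2:]))"
    by (simp add: pderiv_pcompose[of _ "[:0, 1 / 2:]"] pderiv_pCons)
  hence "(A * pderiv (A \<circ>\<^sub>p [:- 1, - 1:])) \<circ>\<^sub>p [:0, 1 / 2:]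
      = smult (- e / 2) ([:0, 1:] * P * pderiv B)"
    by (simp add: pcompose_mult A_scaled A_reflected pderiv_smult pderiv_minus)
  moreover have "2 * poly_integral (- 1 / 2) 0 C = poly_integral (- 1) 0 (C \<circ>\<^sub>p [:0, 1 / 2:])"
    for C :: "'a poly"
    using poly_integral_substitution[of "1 / 2" "- 1" 0 C 0] by simp
  ultimately have "2 * poly_integral (- 1 / 2) 0 (A * pderiv (A \<circ>\<^sub>p [:- 1, - 1:]))
      = - (e / 4 * (2 * poly_integral (- 1) 0 ([:0, 1:] * P * pderiv B)))"
    by (simp only: poly_integral_smult) simp
  also have "2 * poly_integral (- 1) 0 ([:0, 1:] * P * pderiv B)
      = (2 * of_nat a ^ 2 + 2 * of_nat a - 1) / of_nat (2 * a + 1)"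
    unfolding P_def B_def by (rule poly_integral_shifted_legendre_mult_shift)
  finally show ?thesis by (simp add: legendre_ratio_def e_def)
qed

lemma poly_integral_t_newton_poly:
  "poly_integral (- 1) 0 (weighted_t_newton_poly a * (t_newton_poly a \<circ>\<^sub>p [:- 1, - 1:]))
     = 1 / 4 - (- 1) ^ a * legendre_ratio (of_nat a :: 'a :: field_char_0)"
proof -
  define A where "A = ([:0, 1:] * t_newton_poly a :: 'a poly)"
  have "weighted_t_newton_poly a * (t_newton_poly a \<circ>\<^sub>p [:- 1, - 1:])
      = - (pderiv A * (A \<circ>\<^sub>p [:- 1, - 1:]))"
    by (simp add: weighted_t_newton_poly_def A_def pcompose_mult pcompose_pCons algebra_simps)
  hence "poly_integral (- 1) 0 (weighted_t_newton_poly a * (t_newton_poly a \<circ>\<^sub>p [:- 1, - 1:]))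
      = poly A (- (1 / 2)) ^ 2 + 2 * poly_integral (- 1 / 2) 0 (A * pderiv (A \<circ>\<^sub>p [:- 1, - 1:]))"
    using poly_integral_pderiv_mult_reflection[of "- 1" "- 1 / 2" 0 A]
    by (simp add: poly_integral_minus A_def)
  also have "poly A (- (1 / 2)) ^ 2 = 1 / 4"
    by (simp add: A_def t_newton_poly_def poly_pcompose power2_eq_square flip: power_mult_distrib)
  finally show ?thesis
    unfolding A_def poly_integral_half_t_newton_poly by simp
qed

lemma sum_gen_t_poly_square:
  "(\<Sum>n<N. of_nat (n + 1) * gen_t_poly n (of_nat a) ^ 2)
     = (\<Sum>n<N. newton_eval (weighted_t_newton_poly a) (of_nat n)
          * newton_eval (t_newton_poly a \<circ>\<^sub>p [:- 1, - 1:]) (- 1 - of_nat n))"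
  unfolding weighted_t_newton_poly_def newton_eval_mult_Suc newton_eval_reflect
    newton_eval_t_newton_poly
  by (simp add: power2_eq_square mult_ac add.commute)

section \<open>Binomial coefficients modulo p and its square\<close>

lemma binomial_pred_prime_cong:
  assumes "prime p" "k < p"
  shows "[int (p - 1 choose k) = (- 1) ^ k] (mod int p)"
  using \<open>k < p\<close>
proof (induction k)
  case (Suc k)
  have "p = Suc (p - 1)" using \<open>prime p\<close> by (simp add: prime_gt_0_nat)
  hence "(p choose Suc k) = (p - 1 choose k) + (p - 1 choose Suc k)"
    by (metis binomial_Suc_Suc)
  moreover have "p dvd (p choose Suc k)"
    using assms Suc.prems by (intro dvd_choose_prime) auto
  ultimately have "[int (p - 1 choose k) + int (p - 1 choose Suc k) = 0] (mod int p)"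
    by (metis cong_0_iff of_nat_add of_nat_dvd_iff)
  from cong_diff[OF this Suc.IH] Suc.prems show ?case by simp
qed simp

lemma binomial_prime_add_cong:
  assumes "prime p" "l < p"
  shows "[p + l choose l = 1] (mod p)"
proof -
  have "[(\<Sum>i\<le>l. (p choose i) * (l choose (l - i))) = (\<Sum>i\<le>l. if i = 0 then 1 else 0)] (mod p)"
  proof (rule cong_sum)
    fix i assume "i \<in> {..l}"
    hence "p dvd (p choose i)" if "i \<noteq> 0"
      using assms that by (intro dvd_choose_prime) auto
    thus "[(p choose i) * (l choose (l - i)) = (if i = 0 then 1 else 0)] (mod p)"
      by (simp add: cong_0_iff)
  qed
  thus ?thesis by (simp add: vandermonde)
qed

lemma binomial_product_cong_square:
  assumes "prime p" "l < p"
  shows "[int ((p - 1 choose l) * (p + l choose l)) = (- 1) ^ l] (mod int p ^ 2)"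
  using \<open>l < p\<close>
proof (induction l)
  case (Suc l)
  let ?u = "\<lambda>l. int ((p - 1 choose l) * (p + l choose l))"
  have "Suc l ^ 2 * ((p - 1 choose Suc l) * (p + Suc l choose Suc l))
     = (Suc l * (p - 1 choose Suc l)) * (Suc l * (p + Suc l choose Suc l))"
    by (simp only: power2_eq_square mult_ac)
  also have "Suc l * (p - 1 choose Suc l) = (p - 1 - l) * (p - 1 choose l)"
    by (metis binomial_absorb_comp binomial_absorption)
  also have "Suc l * (p + Suc l choose Suc l) = (p + Suc l) * (p + l choose l)"
    using Suc_times_binomial[of l "p + l"] by simp
  also have "(p - 1 - l) * (p - 1 choose l) * ((p + Suc l) * (p + l choose l))
      = (p - 1 - l) * (p + Suc l) * ((p - 1 choose l) * (p + l choose l))"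
    by (simp only: mult_ac)
  finally have "int (Suc l) ^ 2 * ?u (Suc l) = int (p - 1 - l) * int (p + Suc l) * ?u l"
    by (metis of_nat_mult of_nat_power)
  also have "int (p - 1 - l) * int (p + Suc l) = int p ^ 2 - int (Suc l) ^ 2"
    using Suc.prems by (simp add: of_nat_diff algebra_simps power2_eq_square)
  also have "[(int p ^ 2 - int (Suc l) ^ 2) * ?u l
      = (0 - int (Suc l) ^ 2) * (- 1) ^ l] (mod int p ^ 2)"
    using Suc by (intro cong_mult cong_diff) (auto simp: cong_def)
  finally have "[int (Suc l) ^ 2 * ?u (Suc l) = int (Suc l) ^ 2 * (- 1) ^ Suc l] (mod int p ^ 2)"
    by simp
  moreover have "coprime (Suc l) p"
    using assms(1) Suc.prems
    by (metis coprime_commute nat_dvd_not_less prime_imp_coprime zero_less_Suc)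
  hence "coprime (int (Suc l) ^ 2) (int p ^ 2)" by (simp del: of_nat_Suc)
  ultimately show ?case by (simp only: cong_mult_lcancel)
qed simp

lemma prime_dvd_binomial_pred_add:
  assumes "prime p" "0 < m" "m < p"
  shows "p dvd (p - 1 + m choose m)"
proof -
  obtain l where m: "m = Suc l" using \<open>0 < m\<close> gr0_conv_Suc by blast
  have p: "p = Suc (p - 1)" using assms by simp
  have "m * (p - 1 + m choose m) = p * (p - 1 + m choose l)"
    using Suc_times_binomial_add[of l "p - 1"] p by (simp add: m add.commute)
  hence "p dvd m * (p - 1 + m choose m)" by simp
  thus ?thesis
    using assms by (metis nat_dvd_not_less prime_dvd_mult_iff)
qed

section \<open>Powers of the maximal ideal of the p-adic integers\<close>

definition padic_ideal :: "nat \<Rightarrow> 'p :: prime_card padic set" where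
  "padic_ideal j = range (\<lambda>z. of_nat CARD('p) ^ j * to_fract z)"

abbreviation padic_integers :: "'p :: prime_card padic set" where
  "padic_integers \<equiv> padic_ideal 0"

lemma padic_idealI: "x = of_nat CARD('p) ^ j * to_fract z \<Longrightarrow> x \<in> padic_ideal j"
  for x :: "'p :: prime_card padic"
  by (auto simp: padic_ideal_def)

lemma padic_cong_iff_padic_ideal:
  fixes a b :: "'p :: prime_card padic"
  shows "padic_cong a b (CARD('p) ^ j) \<longleftrightarrow> a - b \<in> padic_ideal j"
  by (auto simp: padic_cong_def padic_ideal_def)

lemma to_fract_in_padic_integers [simp]: "to_fract z \<in> padic_integers"
  by (rule padic_idealI[of _ _ z]) simp

lemma padic_ideal_add: "x \<in> padic_ideal j \<Longrightarrow> y \<in> padic_ideal j \<Longrightarrow> x + y \<in> padic_ideal j"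
  by (auto simp: padic_ideal_def intro!: image_eqI[of _ _ "_ + _"]
      simp flip: distrib_left to_fract_add)

lemma padic_ideal_mult: "x \<in> padic_ideal i \<Longrightarrow> y \<in> padic_ideal j \<Longrightarrow> x * y \<in> padic_ideal (i + j)"
  by (auto simp: padic_ideal_def power_add mult_ac intro!: image_eqI[of _ _ "_ * _"])

lemma padic_ideal_mult_left: "x \<in> padic_integers \<Longrightarrow> y \<in> padic_ideal j \<Longrightarrow> x * y \<in> padic_ideal j"
  using padic_ideal_mult[of x 0 y j] by simp

lemma padic_ideal_mult_right: "x \<in> padic_ideal j \<Longrightarrow> y \<in> padic_integers \<Longrightarrow> x * y \<in> padic_ideal j"
  using padic_ideal_mult[of x j y 0] by simp

lemma padic_ideal_0 [simp]: "0 \<in> padic_ideal j"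
  by (rule padic_idealI[of _ _ 0]) simp

lemma of_int_in_padic_integers [simp]: "of_int n \<in> padic_integers"
proof -
  have "to_fract (of_int n :: 'a padic_int) = of_int n"
    by (cases n rule: int_cases2) (simp_all add: to_fract_of_nat)
  thus ?thesis by (metis to_fract_in_padic_integers)
qed

lemma Ints_subset_padic_integers: "\<int> \<subseteq> padic_integers"
  by (auto elim: Ints_cases)

lemma of_nat_in_padic_integers [simp]: "of_nat n \<in> padic_integers"
  and numeral_in_padic_integers [simp]: "numeral m \<in> padic_integers"
  and one_in_padic_integers [simp]: "1 \<in> padic_integers"
  and minus_one_in_padic_integers [simp]: "- 1 \<in> padic_integers"
  by (rule subsetD[OF Ints_subset_padic_integers]; simp)+

lemma padic_ideal_minus: "x \<in> padic_ideal j \<Longrightarrow> - x \<in> padic_ideal j"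
  using padic_ideal_mult_left[of "- 1" x j] by simp

lemma padic_ideal_diff: "x \<in> padic_ideal j \<Longrightarrow> y \<in> padic_ideal j \<Longrightarrow> x - y \<in> padic_ideal j"
  using padic_ideal_add[of x j "- y"] padic_ideal_minus[of y j] by simp

lemma padic_ideal_diff_trans:
  "u - v \<in> padic_ideal j \<Longrightarrow> v - w \<in> padic_ideal j \<Longrightarrow> u - w \<in> padic_ideal j"
  using padic_ideal_add[of "u - v" j "v - w"] by simp

lemma padic_ideal_sum: "(\<And>i. i \<in> A \<Longrightarrow> f i \<in> padic_ideal j) \<Longrightarrow> sum f A \<in> padic_ideal j"
  by (induction A rule: infinite_finite_induct) (simp_all add: padic_ideal_add)

lemma padic_integers_power: "x \<in> padic_integers \<Longrightarrow> x ^ n \<in> padic_integers"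
  by (induction n) (simp_all add: padic_ideal_mult_left)

lemmas padic_ideal_closed = padic_ideal_add padic_ideal_diff padic_ideal_minus
  padic_ideal_mult_left padic_integers_power

lemma power_card_in_padic_ideal:
  "of_nat CARD('p) ^ j \<in> (padic_ideal j :: 'p :: prime_card padic set)"
  by (rule padic_idealI[of _ _ 1]) simp

lemma card_in_padic_ideal [simp]:
  "of_nat CARD('p) \<in> (padic_ideal (Suc 0) :: 'p :: prime_card padic set)"
  using power_card_in_padic_ideal[of 1, where 'p = 'p] by simp

lemma card_mult_in_padic_ideal_2:
  "x \<in> padic_ideal 1 \<Longrightarrow> of_nat CARD('p) * x \<in> padic_ideal 2" for x :: "'p :: prime_card padic"
  using padic_ideal_mult[of "of_nat CARD('p)" 1 x 1] by (simp add: numeral_2_eq_2)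

lemma padic_ideal_le:
  fixes x :: "'p :: prime_card padic"
  assumes "x \<in> padic_ideal j" "i \<le> j"
  shows "x \<in> padic_ideal i"
proof -
  obtain z where "x = of_nat CARD('p) ^ j * to_fract z"
    using assms(1) by (auto simp: padic_ideal_def)
  also have "\<dots> = of_nat CARD('p) ^ i * (of_nat CARD('p) ^ (j - i) * to_fract z)"
    using assms(2) by (simp flip: power_add mult.assoc)
  also have "\<dots> \<in> padic_ideal i"
    by (intro padic_ideal_mult_right power_card_in_padic_ideal padic_ideal_closed) simp_all
  finally show ?thesis .
qed

lemma of_int_in_padic_ideal:
  assumes "int CARD('p) ^ j dvd n"
  shows "of_int n \<in> (padic_ideal j :: 'p :: prime_card padic set)"
  using assms by (auto elim!: dvdE intro!: padic_ideal_mult_right power_card_in_padic_ideal)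

lemma padic_int_of_compatible_residues:
  assumes "\<And>n. [f (Suc n) = f n] (mod int CARD('p) ^ n)"
  shows "\<exists>z :: 'p :: prime_card padic_int. \<forall>n. padic_residue z n = f n mod int CARD('p) ^ n"
proof (intro exI allI)
  define g where "g n = f n mod int CARD('p) ^ n" for n
  have "g (Suc n) mod int CARD('p) ^ n = g n" for n
    using assms[of n] by (simp only: g_def mod_card_pow_Suc cong_def)
  hence "g \<in> {x. \<forall>n. x n \<in> {0..<int CARD('p) ^ n} \<and> x (Suc n) mod int CARD('p) ^ n = x n}"
    by (simp add: g_def)
  thus "padic_residue (Abs_padic_int g :: 'p padic_int) n = f n mod int CARD('p) ^ n" for n
    by (simp add: Abs_padic_int_inverse g_def)
qed

lemma padic_int_is_unit:
  fixes z :: "'p :: prime_card padic_int"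
  assumes "padic_residue z 1 \<noteq> 0"
  obtains w where "z * w = 1"
proof -
  let ?p = "int CARD('p)"
  have coprime: "coprime (padic_residue z n) (?p ^ n)" for n
  proof (cases "n = 0")
    case False
    hence "\<not> ?p dvd padic_residue z n"
      using assms padic_residue_mod[of 1 n z] by (auto simp: dvd_eq_mod_eq_0)
    thus ?thesis
      using prime_imp_coprime[OF prime_card_int[where 'a = 'p]] by (simp add: coprime_commute)
  qed simp
  have "\<exists>x. [padic_residue z n * x = 1] (mod ?p ^ n)" for n
    using cong_solve_coprime_int[OF coprime] .
  then obtain y where y: "\<And>n. [padic_residue z n * y n = 1] (mod ?p ^ n)" by metis
  have "[y (Suc n) = y n] (mod ?p ^ n)" for n
  proof -
    have "[padic_residue z n * y (Suc n) = padic_residue z (Suc n) * y (Suc n)] (mod ?p ^ n)"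
      using padic_residue_mod[of n "Suc n" z]
      by (intro cong_scalar_right) (simp add: cong_def flip: padic_residue_mod[of n "Suc n"])
    also have "[padic_residue z (Suc n) * y (Suc n) = 1] (mod ?p ^ n)"
      using y[of "Suc n"] by (rule cong_dvd_modulus) (simp add: le_imp_power_dvd)
    also have "[1 = padic_residue z n * y n] (mod ?p ^ n)"
      using y by (rule cong_sym)
    finally show ?thesis using coprime by (simp add: cong_mult_lcancel)
  qed
  then obtain w :: "'p padic_int" where w: "\<And>n. padic_residue w n = y n mod ?p ^ n"
    using padic_int_of_compatible_residues by blast
  have "padic_residue (z * w) n = padic_residue (1 :: 'p padic_int) n" for n
    using y[of n] by (simp add: times_padic_int.rep_eq one_padic_int.rep_eq w cong_def mod_simps)
  hence "z * w = 1" by (metis padic_residue_inject ext)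
  thus ?thesis by (rule that)
qed

lemma inverse_in_padic_integers:
  fixes x :: "'p :: prime_card padic"
  assumes "x \<in> padic_integers" "x \<notin> padic_ideal 1"
  shows "inverse x \<in> padic_integers"
proof -
  obtain z where z: "x = to_fract z" using assms(1) by (auto simp: padic_ideal_def)
  have "padic_residue z 1 \<noteq> 0"
    using assms(2) unfolding padic_residue_1_eq_0_iff z
    by (metis padic_idealI power_one_right to_fract_mult to_fract_of_nat)
  then obtain w where "z * w = 1" by (rule padic_int_is_unit)
  hence "x * to_fract w = 1" by (simp add: z flip: to_fract_mult)
  hence "inverse x = to_fract w" by (rule inverse_unique)
  thus ?thesis by simp
qed

lemma divide_in_padic_ideal:
  fixes x y :: "'p :: prime_card padic"
  assumes "x \<in> padic_ideal j" "y \<in> padic_integers" "y \<notin> padic_ideal 1"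
  shows "x / y \<in> padic_ideal j"
  unfolding divide_inverse
  using assms by (intro padic_ideal_mult_right inverse_in_padic_integers)

lemma of_nat_in_padic_ideal_1_iff:
  "of_nat n \<in> (padic_ideal 1 :: 'p :: prime_card padic set) \<longleftrightarrow> CARD('p) dvd n"
proof
  assume "of_nat n \<in> (padic_ideal 1 :: 'p padic set)"
  then obtain z where "(of_nat n :: 'p padic) = of_nat CARD('p) * to_fract z"
    by (auto simp: padic_ideal_def)
  hence "(of_nat n :: 'p padic_int) = of_nat CARD('p) * z"
    by (metis to_fract_eq_iff to_fract_mult to_fract_of_nat)
  hence "padic_residue (of_nat n :: 'p padic_int) 1 = 0"
    unfolding padic_residue_1_eq_0_iff by blast
  thus "CARD('p) dvd n"
    by (simp add: padic_residue_of_nat dvd_eq_mod_eq_0 flip: of_nat_mod)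
next
  assume "CARD('p) dvd n"
  thus "of_nat n \<in> (padic_ideal 1 :: 'p padic set)"
    using of_int_in_padic_ideal[of 1 "int n", where 'p = 'p] by simp
qed

lemma divide_of_nat_in_padic_ideal:
  fixes x :: "'p :: prime_card padic"
  assumes "x \<in> padic_ideal j" "\<not> CARD('p) dvd n"
  shows "x / of_nat n \<in> padic_ideal j"
  using assms
  by (intro divide_in_padic_ideal)
    (simp_all only: of_nat_in_padic_ideal_1_iff of_nat_in_padic_integers simp_thms)

lemma divide_2_in_padic_ideal:
  fixes x :: "'p :: prime_card padic"
  assumes "odd CARD('p)" "x \<in> padic_ideal j"
  shows "x / 2 \<in> padic_ideal j"
proof -
  have "\<not> CARD('p) dvd 2"
    using assms(1) by (metis primes_dvd_imp_eq two_is_prime_nat prime_card)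
  from divide_of_nat_in_padic_ideal[OF assms(2) this] show ?thesis by simp
qed

lemma card_divide_of_nat_in_padic_integers:
  assumes "\<not> CARD('p) ^ 2 dvd m"
  shows "of_nat CARD('p) / of_nat m \<in> (padic_integers :: 'p :: prime_card padic set)"
proof (cases "CARD('p) dvd m")
  case True
  then obtain c where m: "m = CARD('p) * c" by (elim dvdE)
  hence "\<not> CARD('p) dvd c" using assms by (auto simp: power2_eq_square)
  hence "1 / of_nat c \<in> (padic_integers :: 'p padic set)"
    by (intro divide_of_nat_in_padic_ideal) simp_all
  thus ?thesis by (simp add: m)
next
  case False
  thus ?thesis by (intro divide_of_nat_in_padic_ideal) simp_all
qed

section \<open>Sums of products of Newton series modulo the square of p\<close>

lemma sum_binomial_product_cong:
  assumes odd: "odd CARD('p)" and kl: "k < CARD('p)" "l < CARD('p)"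
  shows "of_nat (\<Sum>n<CARD('p). (n choose k) * (n + l choose l))
      - of_nat CARD('p) * (- 1) ^ k / of_nat (Suc (k + l))
     \<in> (padic_ideal 2 :: 'p :: prime_card padic set)"
proof -
  let ?p = "CARD('p)"
  define S where "S = (\<Sum>n<?p. (n choose k) * (n + l choose l))"
  define m where "m = Suc (k + l)"
  have prime: "prime ?p" by (rule prime_card)
  have "of_nat S - of_nat ?p * (- 1) ^ k / of_nat m \<in> (padic_ideal 2 :: 'p padic set)"
  proof (cases "?p dvd m")
    case True
    moreover have "0 < m" "m < 2 * ?p" using kl by (simp_all add: m_def)
    ultimately have m_eq: "m = ?p" by (auto elim!: dvdE)
    hence "even (k + l)" using odd unfolding m_def by (metis even_Suc)
    hence "[int S = (- 1) ^ k] (mod int ?p ^ 2)"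
      using binomial_product_cong_square[OF prime kl(2)] m_eq
      by (simp add: S_def m_def sum_binomial_product_complementary minus_one_power_iff)
    hence "of_int (int S - (- 1) ^ k) \<in> (padic_ideal 2 :: 'p padic set)"
      unfolding cong_iff_dvd_diff by (rule of_int_in_padic_ideal)
    thus ?thesis by (simp add: m_eq)
  next
    case False
    define b where "b = (?p - 1 choose k) * (?p + l choose l)"
    have "m * S = ?p * b"
      using sum_binomial_product[of k l ?p] by (simp add: S_def m_def b_def mult.assoc)
    moreover have "(of_nat m :: 'p padic) \<noteq> 0" by (simp add: m_def del: of_nat_Suc)
    ultimately have S_eq: "(of_nat S :: 'p padic) = of_nat ?p * of_nat b / of_nat m"
      by (simp add: eq_divide_eq mult.commute flip: of_nat_mult)
    have "[int b = (- 1) ^ k * int 1] (mod int ?p)"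
      unfolding b_def of_nat_mult
      using binomial_pred_prime_cong[OF prime kl(1)] binomial_prime_add_cong[OF prime kl(2)]
      by (intro cong_mult) (simp_all only: cong_int_iff)
    hence "of_int (int b - (- 1) ^ k) \<in> (padic_ideal 1 :: 'p padic set)"
      by (intro of_int_in_padic_ideal) (simp add: cong_iff_dvd_diff)
    hence "of_nat ?p * of_int (int b - (- 1) ^ k) / of_nat m \<in> (padic_ideal 2 :: 'p padic set)"
      by (intro divide_of_nat_in_padic_ideal card_mult_in_padic_ideal_2 False)
    thus ?thesis by (simp add: S_eq right_diff_distrib diff_divide_distrib)
  qed
  thus ?thesis by (simp only: S_def m_def)
qed

lemma Suc_add_not_dvd_square:
  fixes p :: nat
  assumes "2 < p" "k \<le> p" "l < p"
  shows "\<not> p ^ 2 dvd Suc (k + l)"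
proof -
  have "Suc (k + l) \<le> 2 * p" using assms by simp
  also have "\<dots> < p ^ 2" using assms by (simp add: power2_eq_square)
  finally show ?thesis by (simp add: nat_dvd_not_less)
qed

lemma sum_binomial_product_card_integral:
  assumes odd: "odd CARD('p)" and l: "l < CARD('p)"
  shows "of_nat (\<Sum>n<CARD('p). (n choose CARD('p)) * (n + l choose l))
      - of_nat CARD('p) * (- 1) ^ CARD('p) / of_nat (Suc (CARD('p) + l))
     \<in> (padic_integers :: 'p :: prime_card padic set)"
proof -
  let ?p = "CARD('p)"
  have "2 < ?p"
    using odd prime_ge_2_nat[OF prime_card[where 'a = 'p]] by (cases "?p = 2") auto
  hence "of_nat ?p / of_nat (Suc (?p + l)) \<in> (padic_integers :: 'p padic set)"
    using l by (intro card_divide_of_nat_in_padic_integers Suc_add_not_dvd_square) auto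
  moreover have "(\<Sum>n<?p. (n choose ?p) * (n + l choose l)) = 0"
    by (simp add: binomial_eq_0)
  ultimately show ?thesis
    using odd by (simp only: power_minus_odd of_nat_0) simp
qed

text \<open>
  Degree \<open>p\<close> is allowed for \<open>f\<close> because the integral of \<open>x\<^sup>p x\<^sup>l\<close> has at most one \<open>p\<close> in its
  denominator.
\<close>

lemma sum_newton_eval_mult_cong_poly_integral:
  fixes f g :: "'p :: prime_card padic poly"
  assumes odd: "odd CARD('p)"
    and f: "\<And>k. coeff f k \<in> padic_integers" "degree f \<le> CARD('p)" "coeff f CARD('p) \<in> padic_ideal 2"
    and g: "\<And>l. coeff g l \<in> padic_integers" "degree g < CARD('p)"
  shows "(\<Sum>n<CARD('p). newton_eval f (of_nat n) * newton_eval g (- 1 - of_nat n))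
      - of_nat CARD('p) * poly_integral (- 1) 0 (f * g) \<in> padic_ideal 2"
proof -
  let ?p = "CARD('p)"
  let ?S = "\<lambda>k l. \<Sum>n<?p. (n choose k) * (n + l choose l)"
  let ?d = "\<lambda>k l. of_nat (?S k l) - of_nat ?p * (- 1) ^ k / (of_nat (Suc (k + l)) :: 'p padic)"
  have scaled: "coeff f k * ?d k l \<in> padic_ideal 2" if "k \<le> degree f" "l \<le> degree g" for k l
  proof (cases "k = ?p")
    case True
    have "l < ?p" using that g(2) by simp
    from padic_ideal_mult_right[OF f(3) sum_binomial_product_card_integral[OF odd this]]
    show ?thesis by (simp only: True)
  next
    case False
    hence "?d k l \<in> padic_ideal 2"
      using that f(2) g(2) by (intro sum_binomial_product_cong odd) auto
    thus ?thesis by (rule padic_ideal_mult_left[OF f(1)])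
  qed
  have "coeff g l * (- 1) ^ l \<in> padic_integers" for l
    by (intro padic_ideal_mult_left g(1) padic_integers_power) simp
  hence "coeff g l * (- 1) ^ l * (coeff f k * ?d k l) \<in> padic_ideal 2"
    if "k \<le> degree f" "l \<le> degree g" for k l
    using scaled[OF that] by (rule padic_ideal_mult_left)
  hence "(\<Sum>k\<le>degree f. \<Sum>l\<le>degree g. coeff g l * (- 1) ^ l * (coeff f k * ?d k l)) \<in> padic_ideal 2"
    by (intro padic_ideal_sum) simp
  also have "(\<Sum>k\<le>degree f. \<Sum>l\<le>degree g. coeff g l * (- 1) ^ l * (coeff f k * ?d k l))
      = (\<Sum>n<?p. newton_eval f (of_nat n) * newton_eval g (- 1 - of_nat n))
        - of_nat ?p * poly_integral (- 1) 0 (f * g)"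
    unfolding sum_newton_eval_mult poly_integral_def moment_functional_mult sum_distrib_left
      sum_subtractf[symmetric]
    by (intro sum.cong refl) (simp add: power_add algebra_simps del: of_nat_Suc of_nat_sum)
  finally show ?thesis .
qed

definition weighted_t_square_sum :: "'p :: prime_card padic \<Rightarrow> 'p padic" where
  "weighted_t_square_sum x = (\<Sum>n<CARD('p). of_nat (n + 1) * gen_t_poly n x ^ 2)"

lemma weighted_t_square_sum_reflect: "weighted_t_square_sum (- 1 - x) = weighted_t_square_sum x"
  by (simp add: weighted_t_square_sum_def gen_t_poly_reflect)

lemma coeff_t_newton_poly_in_Ints: "coeff (t_newton_poly a) k \<in> \<int>"
  by (simp add: coeff_t_newton_poly)

lemma coeff_weighted_t_newton_poly_card:
  assumes "a < CARD('p)" "odd CARD('p)"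
  shows "coeff (weighted_t_newton_poly a) CARD('p) \<in> (padic_ideal 2 :: 'p :: prime_card padic set)"
proof -
  let ?p = "CARD('p)"
  have prime: "prime ?p" by (rule prime_card)
  have "?p dvd (a choose (?p - 1)) * (a + (?p - 1) choose (?p - 1))"
    using assms prime_dvd_binomial_pred_add[OF prime, of "?p - 1"] prime_gt_1_nat[OF prime]
    by (cases "a = ?p - 1") (auto simp: binomial_eq_0)
  hence "of_nat (2 ^ (?p - 1) * ((a choose (?p - 1)) * (a + (?p - 1) choose (?p - 1))))
      \<in> (padic_ideal 1 :: 'p padic set)"
    unfolding of_nat_in_padic_ideal_1_iff by simp
  hence "coeff (t_newton_poly a) (?p - 1) \<in> (padic_ideal 1 :: 'p padic set)"
    by (simp add: coeff_t_newton_poly)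
  moreover have "coeff (weighted_t_newton_poly a) ?p
      = (of_nat ?p * coeff (t_newton_poly a) (?p - 1) :: 'p padic)"
    using assms by (simp add: coeff_weighted_t_newton_poly coeff_eq_0)
  ultimately show ?thesis by (simp only: card_mult_in_padic_ideal_2)
qed

lemma weighted_t_square_sum_of_nat:
  assumes odd: "odd CARD('p)" and a: "a < CARD('p)"
  shows "weighted_t_square_sum (of_nat a)
      - of_nat CARD('p) * (1 / 4 - (- 1) ^ a * legendre_ratio (of_nat a))
     \<in> (padic_ideal 2 :: 'p :: prime_card padic set)"
  unfolding weighted_t_square_sum_def sum_gen_t_poly_square poly_integral_t_newton_poly[symmetric]
proof (rule sum_newton_eval_mult_cong_poly_integral[OF odd])
  show "coeff (weighted_t_newton_poly a) k \<in> (padic_integers :: 'p padic set)" for k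
    using Ints_subset_padic_integers
    by (rule subsetD) (simp add: coeff_weighted_t_newton_poly coeff_t_newton_poly_in_Ints)
  show "coeff (t_newton_poly a \<circ>\<^sub>p [:- 1, - 1:]) l \<in> (padic_integers :: 'p padic set)" for l
    using Ints_subset_padic_integers
    by (rule subsetD)
      (auto simp: coeff_pCons coeff_t_newton_poly_in_Ints split: nat.split
        intro!: coeff_pcompose_semiring_closed)
  show "degree (weighted_t_newton_poly a :: 'p padic poly) \<le> CARD('p)"
    using degree_weighted_t_newton_poly a by (rule order_trans[OF _ Suc_leI])
  show "degree (t_newton_poly a \<circ>\<^sub>p [:- 1, - 1:] :: 'p padic poly) < CARD('p)"
    using a by (simp add: degree_pcompose)
qed (rule coeff_weighted_t_newton_poly_card[OF a odd])

section \<open>Dependence on x within a residue class\<close>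

text \<open>
  Modulo \<open>p\<^sup>2\<close> a polynomial with \<open>p\<close>-integral coefficients is affine on every residue class
  modulo \<open>p\<close>.
\<close>

definition affine_mod_square :: "('p :: prime_card padic \<Rightarrow> 'p padic) \<Rightarrow> 'p padic \<Rightarrow> bool" where
  "affine_mod_square F x \<longleftrightarrow> F x \<in> padic_integers \<and>
     (\<exists>d\<in>padic_integers. \<forall>y\<in>padic_integers.
        F (x + of_nat CARD('p) * y) - (F x + of_nat CARD('p) * y * d) \<in> padic_ideal 2)"

lemma affine_mod_square_const: "c \<in> padic_integers \<Longrightarrow> affine_mod_square (\<lambda>_. c) x"
  by (auto simp: affine_mod_square_def intro!: bexI[of _ 0])

lemma affine_mod_square_ident: "x \<in> padic_integers \<Longrightarrow> affine_mod_square (\<lambda>x. x) x"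
  by (auto simp: affine_mod_square_def intro!: bexI[of _ 1])

lemma affine_mod_squareE:
  fixes F :: "'p :: prime_card padic \<Rightarrow> 'p padic"
  assumes "affine_mod_square F x"
  obtains d where "F x \<in> padic_integers" "d \<in> padic_integers"
    "\<And>y. y \<in> padic_integers \<Longrightarrow>
       F (x + of_nat CARD('p) * y) - (F x + of_nat CARD('p) * y * d) \<in> padic_ideal 2"
  using assms unfolding affine_mod_square_def by blast

lemma affine_mod_square_add:
  fixes F G :: "'p :: prime_card padic \<Rightarrow> 'p padic"
  assumes "affine_mod_square F x" "affine_mod_square G x"
  shows "affine_mod_square (\<lambda>x. F x + G x) x"
proof -
  let ?p = "of_nat CARD('p) :: 'p padic"
  obtain c where Fx: "F x \<in> padic_integers" and c: "c \<in> padic_integers"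
    and F_cong: "\<And>y. y \<in> padic_integers \<Longrightarrow> F (x + ?p * y) - (F x + ?p * y * c) \<in> padic_ideal 2"
    using assms(1) by (rule affine_mod_squareE) blast
  obtain d where Gx: "G x \<in> padic_integers" and d: "d \<in> padic_integers"
    and G_cong: "\<And>y. y \<in> padic_integers \<Longrightarrow> G (x + ?p * y) - (G x + ?p * y * d) \<in> padic_ideal 2"
    using assms(2) by (rule affine_mod_squareE) blast
  have "F (x + ?p * y) + G (x + ?p * y) - (F x + G x + ?p * y * (c + d)) \<in> padic_ideal 2"
    if "y \<in> padic_integers" for y
    using padic_ideal_add[OF F_cong[OF that] G_cong[OF that]] by (simp add: algebra_simps)
  thus ?thesis
    using padic_ideal_add[OF Fx Gx] padic_ideal_add[OF c d] by (auto simp: affine_mod_square_def)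
qed

lemma affine_mod_square_mult:
  fixes F G :: "'p :: prime_card padic \<Rightarrow> 'p padic"
  assumes "affine_mod_square F x" "affine_mod_square G x"
  shows "affine_mod_square (\<lambda>x. F x * G x) x"
proof -
  let ?p = "of_nat CARD('p) :: 'p padic"
  obtain c where Fx: "F x \<in> padic_integers" and c: "c \<in> padic_integers"
    and F_cong: "\<And>y. y \<in> padic_integers \<Longrightarrow> F (x + ?p * y) - (F x + ?p * y * c) \<in> padic_ideal 2"
    using assms(1) by (rule affine_mod_squareE) blast
  obtain d where Gx: "G x \<in> padic_integers" and d: "d \<in> padic_integers"
    and G_cong: "\<And>y. y \<in> padic_integers \<Longrightarrow> G (x + ?p * y) - (G x + ?p * y * d) \<in> padic_ideal 2"
    using assms(2) by (rule affine_mod_squareE) blast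
  have "F (x + ?p * y) * G (x + ?p * y) - (F x * G x + ?p * y * (F x * d + c * G x))
      \<in> padic_ideal 2" if y: "y \<in> padic_integers" for y
  proof -
    define u where "u = F (x + ?p * y) - (F x + ?p * y * c)"
    define v where "v = G (x + ?p * y) - (G x + ?p * y * d)"
    have uv: "u \<in> padic_ideal 2" "v \<in> padic_ideal 2"
      using F_cong[OF y] G_cong[OF y] by (simp_all add: u_def v_def)
    have "F (x + ?p * y) * G (x + ?p * y) - (F x * G x + ?p * y * (F x * d + c * G x))
        = y * y * c * d * ?p ^ 2 + (G x + ?p * y * d + v) * u + (F x + ?p * y * c) * v"
      by (simp add: u_def v_def algebra_simps power2_eq_square)
    also have "\<dots> \<in> padic_ideal 2"
      by (intro padic_ideal_closed uv power_card_in_padic_ideal y c d Fx Gx of_nat_in_padic_integers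
          padic_ideal_le[OF uv(2)]) simp
    finally show ?thesis .
  qed
  moreover have "F x * G x \<in> padic_integers" "F x * d + c * G x \<in> padic_integers"
    by (intro padic_ideal_closed c d Fx Gx)+
  ultimately show ?thesis by (auto simp: affine_mod_square_def)
qed

lemma affine_mod_square_sum:
  "(\<And>i. i \<in> A \<Longrightarrow> affine_mod_square (F i) x) \<Longrightarrow> affine_mod_square (\<lambda>x. \<Sum>i\<in>A. F i x) x"
  by (induction A rule: infinite_finite_induct)
    (simp_all add: affine_mod_square_add affine_mod_square_const)

lemma affine_mod_square_prod:
  "(\<And>i. i \<in> A \<Longrightarrow> affine_mod_square (F i) x) \<Longrightarrow> affine_mod_square (\<lambda>x. \<Prod>i\<in>A. F i x) x"
  by (induction A rule: infinite_finite_induct)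
    (simp_all add: affine_mod_square_mult affine_mod_square_const)

lemma affine_mod_square_gbinomial:
  fixes F :: "'p :: prime_card padic \<Rightarrow> 'p padic"
  assumes "affine_mod_square F x" "k < CARD('p)"
  shows "affine_mod_square (\<lambda>x. F x gchoose k) x"
proof -
  have "\<not> CARD('p) dvd fact k"
    using assms(2) prime_dvd_fact_iff[OF prime_card[where 'a = 'p]] by simp
  hence "1 / of_nat (fact k) \<in> (padic_integers :: 'p padic set)"
    by (intro divide_of_nat_in_padic_ideal) simp_all
  hence "affine_mod_square (\<lambda>x. (\<Prod>i=0..<k. F x + - of_nat i) * (1 / of_nat (fact k))) x"
    by (intro affine_mod_square_mult affine_mod_square_prod affine_mod_square_add
        affine_mod_square_const padic_ideal_minus assms(1)) simp_all
  thus ?thesis by (simp add: gbinomial_prod_rev)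
qed

lemma affine_mod_square_gen_t_poly:
  fixes x :: "'p :: prime_card padic"
  assumes "x \<in> padic_integers" "n < CARD('p)"
  shows "affine_mod_square (gen_t_poly n) x"
  unfolding gen_t_poly_def
  using assms
  by (intro affine_mod_square_sum affine_mod_square_mult affine_mod_square_gbinomial
      affine_mod_square_add affine_mod_square_ident affine_mod_square_const padic_integers_power)
    simp_all

lemma affine_mod_square_weighted_t_square_sum:
  "x \<in> padic_integers \<Longrightarrow> affine_mod_square weighted_t_square_sum x"
  unfolding weighted_t_square_sum_def power2_eq_square
  by (intro affine_mod_square_sum affine_mod_square_mult affine_mod_square_gen_t_poly
      affine_mod_square_const of_nat_in_padic_integers) simp_all

lemma affine_mod_square_interpolation:
  fixes F :: "'p :: prime_card padic \<Rightarrow> 'p padic"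
  assumes "affine_mod_square F x" and y: "y \<in> padic_integers"
  shows "F (x + of_nat CARD('p) * y) - (F x + y * (F x - F (x - of_nat CARD('p)))) \<in> padic_ideal 2"
proof -
  let ?p = "of_nat CARD('p) :: 'p padic"
  obtain d where F_cong:
    "\<And>y. y \<in> padic_integers \<Longrightarrow> F (x + ?p * y) - (F x + ?p * y * d) \<in> padic_ideal 2"
    using assms(1) by (rule affine_mod_squareE) blast
  have "F (x + ?p * y) - (F x + y * (F x - F (x - ?p)))
      = (F (x + ?p * y) - (F x + ?p * y * d)) + y * (F (x - ?p) - (F x - ?p * d))"
    by (simp add: algebra_simps)
  also have "\<dots> \<in> padic_ideal 2"
    using padic_ideal_add[OF F_cong[OF y] padic_ideal_mult_left[OF y F_cong[of "- 1"]]] by simp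
  finally show ?thesis .
qed

section \<open>Evaluation of the sum modulo the square of p\<close>

lemma weighted_t_square_sum_of_nat_minus_card:
  assumes odd: "odd CARD('p)" and a: "a < CARD('p)"
  shows "weighted_t_square_sum (of_nat a - of_nat CARD('p))
      - of_nat CARD('p) * (1 / 4 + (- 1) ^ a * legendre_ratio (of_nat a - of_nat CARD('p)))
     \<in> (padic_ideal 2 :: 'p :: prime_card padic set)"
proof -
  define b where "b = CARD('p) - 1 - a"
  have b_eq: "of_nat a - of_nat CARD('p) = - 1 - (of_nat b :: 'p padic)"
    using a by (simp add: b_def of_nat_diff)
  have "even (a + b)" using a odd by (simp add: b_def)
  hence "(- 1 :: 'p padic) ^ b = (- 1) ^ a"
    by (auto simp: minus_one_power_iff)
  moreover have "weighted_t_square_sum (of_nat b)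
      - of_nat CARD('p) * (1 / 4 - (- 1) ^ b * legendre_ratio (of_nat b))
     \<in> (padic_ideal 2 :: 'p :: prime_card padic set)"
    using odd a by (intro weighted_t_square_sum_of_nat) (simp_all add: b_def)
  ultimately show ?thesis
    unfolding b_eq weighted_t_square_sum_reflect legendre_ratio_reflect by simp
qed

lemma weighted_t_square_sum_cong:
  fixes y :: "'p :: prime_card padic"
  assumes odd: "odd CARD('p)" and a: "a < CARD('p)" and y: "y \<in> padic_integers"
  shows "weighted_t_square_sum (of_nat a + of_nat CARD('p) * y)
      - of_nat CARD('p) * (1 / 4 - (- 1) ^ a * (legendre_ratio (of_nat a)
          + y * (legendre_ratio (of_nat a) + legendre_ratio (of_nat a - of_nat CARD('p)))))
     \<in> padic_ideal 2"
proof -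
  let ?p = "of_nat CARD('p) :: 'p padic" and ?a = "of_nat a :: 'p padic"
  let ?F = "weighted_t_square_sum :: 'p padic \<Rightarrow> 'p padic"
  let ?r = "legendre_ratio :: 'p padic \<Rightarrow> 'p padic"
  define u where "u = ?F ?a - ?p * (1 / 4 - (- 1) ^ a * ?r ?a)"
  define v where "v = ?F (?a - ?p) - ?p * (1 / 4 + (- 1) ^ a * ?r (?a - ?p))"
  have uv: "u \<in> padic_ideal 2" "v \<in> padic_ideal 2"
    using weighted_t_square_sum_of_nat[OF odd a] weighted_t_square_sum_of_nat_minus_card[OF odd a]
    by (simp_all add: u_def v_def)
  have "?F (?a + ?p * y) - (?F ?a + y * (?F ?a - ?F (?a - ?p))) \<in> padic_ideal 2"
    by (intro affine_mod_square_interpolation affine_mod_square_weighted_t_square_sum y) simp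
  moreover have "u + y * (u - v) \<in> padic_ideal 2"
    by (intro padic_ideal_closed uv y)
  ultimately have "?F (?a + ?p * y) - (?F ?a + y * (?F ?a - ?F (?a - ?p)))
      + (u + y * (u - v)) \<in> padic_ideal 2"
    by (rule padic_ideal_add)
  thus ?thesis by (simp add: u_def v_def algebra_simps)
qed

lemma legendre_ratio_cong:
  fixes x y :: "'p :: prime_card padic"
  assumes odd: "odd CARD('p)" and x: "x \<in> padic_integers" and y: "y \<in> padic_integers"
    and xy: "x - y \<in> padic_ideal 1" and unit: "2 * x + 1 \<notin> padic_ideal 1"
  shows "legendre_ratio x - legendre_ratio y \<in> padic_ideal 1"
proof -
  have "2 * x + 1 - (2 * y + 1) = 2 * (x - y)" by simp
  also have "\<dots> \<in> padic_ideal 1" using xy by (intro padic_ideal_mult_left) simp_all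
  finally have unit': "2 * y + 1 \<notin> padic_ideal 1"
    using unit padic_ideal_add[of "2 * x + 1 - (2 * y + 1)" 1 "2 * y + 1"] by auto
  define s t where "s = 2 * x + 1" and "t = 2 * y + 1"
  have st: "s \<in> padic_integers" "s \<notin> padic_ideal 1" "t \<in> padic_integers" "t \<notin> padic_ideal 1"
    unfolding s_def t_def using unit unit'
    by (simp_all add: padic_ideal_add padic_ideal_mult_left x y)
  hence "s \<noteq> 0" "t \<noteq> 0" by (metis padic_ideal_0)+
  hence "legendre_ratio x - legendre_ratio y = ((s - t) + 3 * (s - t) / s / t) / 2 / 2 / 2"
    unfolding legendre_ratio_altdef s_def[symmetric] t_def[symmetric] by (simp add: field_simps)
  also have "s - t = 2 * (x - y)"
    by (simp add: s_def t_def)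
  also have "(2 * (x - y) + 3 * (2 * (x - y)) / s / t) / 2 / 2 / 2 \<in> padic_ideal 1"
    by (intro divide_2_in_padic_ideal divide_in_padic_ideal padic_ideal_add padic_ideal_mult_left
        odd st xy) simp_all
  finally show ?thesis .
qed

lemma weighted_t_square_sum_cong_unit:
  fixes y :: "'p :: prime_card padic"
  assumes odd: "odd CARD('p)" and a: "a < CARD('p)" and y: "y \<in> padic_integers"
  defines "x \<equiv> of_nat a + of_nat CARD('p) * y"
  assumes unit: "2 * x + 1 \<notin> padic_ideal 1"
  shows "weighted_t_square_sum x
      - of_nat CARD('p) * (1 / 4 - (- 1) ^ a * (legendre_ratio x * (1 + 2 * y))) \<in> padic_ideal 2"
proof -
  let ?p = "of_nat CARD('p) :: 'p padic" and ?a = "of_nat a :: 'p padic"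
  let ?r = "legendre_ratio :: 'p padic \<Rightarrow> 'p padic"
  define c where "c = ?r x - ?r ?a"
  define d where "d = ?r x - ?r (?a - ?p)"
  have x: "x \<in> padic_integers"
    unfolding x_def by (intro padic_ideal_closed y of_nat_in_padic_integers)
  have "x - ?a = ?p * y" "x - (?a - ?p) = ?p * (y + 1)"
    by (simp_all add: x_def algebra_simps)
  hence "x - ?a \<in> padic_ideal 1" "x - (?a - ?p) \<in> padic_ideal 1"
    using y by (simp_all add: padic_ideal_mult_right padic_ideal_add)
  hence cd: "c \<in> padic_ideal 1" "d \<in> padic_ideal 1"
    unfolding c_def d_def using legendre_ratio_cong[OF odd x _ _ unit]
    by (simp_all add: padic_ideal_diff)
  have "weighted_t_square_sum x
      - ?p * (1 / 4 - (- 1) ^ a * (?r ?a + y * (?r ?a + ?r (?a - ?p)))) \<in> padic_ideal 2"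
    unfolding x_def by (rule weighted_t_square_sum_cong[OF odd a y])
  moreover have "?p * ((- 1) ^ a * (c + y * (c + d))) \<in> padic_ideal 2"
    by (intro card_mult_in_padic_ideal_2 padic_ideal_closed cd y) simp
  ultimately have "weighted_t_square_sum x
      - ?p * (1 / 4 - (- 1) ^ a * (?r ?a + y * (?r ?a + ?r (?a - ?p))))
      + ?p * ((- 1) ^ a * (c + y * (c + d))) \<in> padic_ideal 2"
    by (rule padic_ideal_add)
  thus ?thesis by (simp add: c_def d_def algebra_simps)
qed

lemma weighted_t_square_sum_cong_half:
  fixes y :: "'p :: prime_card padic"
  assumes p: "CARD('p) = 2 * a + 1" and y: "y \<in> padic_integers"
  shows "weighted_t_square_sum (of_nat a + of_nat CARD('p) * y)
      - (of_nat CARD('p) / 4 + 3 / 8 * (- 1) ^ a) \<in> padic_ideal 2"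
proof -
  let ?p = "of_nat CARD('p) :: 'p padic" and ?a = "of_nat a :: 'p padic"
  have odd: "odd CARD('p)" by (simp add: p)
  have p_eq: "?p = 2 * ?a + 1" by (simp add: p)
  have "?p \<noteq> 0" by simp
  have "?a - ?p = - 1 - ?a" by (simp add: p_eq)
  hence "legendre_ratio (?a - ?p) = - legendre_ratio ?a" by (simp only: legendre_ratio_reflect)
  hence "weighted_t_square_sum (?a + ?p * y) - ?p * (1 / 4 - (- 1) ^ a * legendre_ratio ?a)
      \<in> padic_ideal 2"
    using weighted_t_square_sum_cong[OF odd _ y, of a] by (simp add: p)
  moreover have "?p * (1 / 4 - (- 1) ^ a * legendre_ratio ?a) - (?p / 4 + 3 / 8 * (- 1) ^ a)
      \<in> padic_ideal 2"
  proof -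
    have "legendre_ratio ?a = (?p - 3 / ?p) / 8"
      by (simp only: legendre_ratio_altdef p_eq)
    hence ratio: "?p * legendre_ratio ?a = ?p ^ 2 / 8 - 3 / 8"
      using \<open>?p \<noteq> 0\<close> by (simp add: field_simps power2_eq_square)
    have "?p * (1 / 4 - (- 1) ^ a * legendre_ratio ?a)
        = ?p / 4 - (- 1) ^ a * (?p * legendre_ratio ?a)"
      by (simp add: algebra_simps)
    hence "?p * (1 / 4 - (- 1) ^ a * legendre_ratio ?a) - (?p / 4 + 3 / 8 * (- 1) ^ a)
        = - ((- 1) ^ a) * ?p ^ 2 / 2 / 2 / 2"
      unfolding ratio by (simp add: algebra_simps)
    also have "\<dots> \<in> padic_ideal 2"
      by (intro divide_2_in_padic_ideal odd padic_ideal_closed power_card_in_padic_ideal) simp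
    finally show ?thesis .
  qed
  ultimately show ?thesis by (rule padic_ideal_diff_trans)
qed

lemma least_residue_decomposition:
  fixes x :: "'p :: prime_card padic_int"
  obtains y where "y \<in> padic_integers" "least_residue x < CARD('p)"
    "to_fract x = of_nat (least_residue x) + of_nat CARD('p) * y"
proof -
  have "padic_residue x 1 \<in> {0..<int CARD('p)}"
    using padic_residue[of x] by (auto dest: spec[of _ 1])
  hence "padic_residue x 1 = int (least_residue x)" and lt: "least_residue x < CARD('p)"
    by (auto simp: least_residue_eq)
  hence "padic_cong (to_fract x) (of_nat (least_residue x)) CARD('p)"
    by (simp add: padic_cong_of_nat_iff)
  then obtain z where "to_fract x - of_nat (least_residue x) = of_nat CARD('p) * to_fract z"
    by (auto simp: padic_cong_def)
  thus ?thesis using lt by (intro that[of "to_fract z"]) (simp_all add: algebra_simps)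
qed

lemma padic_cong_minus_half_iff:
  fixes x :: "'p :: prime_card padic"
  assumes "odd CARD('p)"
  shows "padic_cong x (- 1 / 2) CARD('p) \<longleftrightarrow> 2 * x + 1 \<in> padic_ideal 1"
proof -
  have "x + 1 / 2 = (2 * x + 1) / 2" "2 * x + 1 = 2 * (x + 1 / 2)"
    by (simp_all add: field_simps)
  hence "x + 1 / 2 \<in> padic_ideal 1 \<longleftrightarrow> 2 * x + 1 \<in> padic_ideal 1"
    using divide_2_in_padic_ideal[OF assms] padic_ideal_mult_left[OF numeral_in_padic_integers]
    by metis
  thus ?thesis using padic_cong_iff_padic_ideal[of x "- 1 / 2" 1] by simp
qed

lemma least_residue_minus_half:
  fixes y :: "'p :: prime_card padic"
  assumes "2 * (of_nat a + of_nat CARD('p) * y) + 1 \<in> padic_ideal 1"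
    and "a < CARD('p)" "y \<in> padic_integers"
  shows "CARD('p) = 2 * a + 1"
proof -
  have "of_nat CARD('p) * (2 * y) \<in> padic_ideal 1"
    using assms(3) by (intro padic_ideal_mult_right padic_ideal_mult_left) simp_all
  from padic_ideal_diff[OF assms(1) this]
  have "of_nat (2 * a + 1) \<in> (padic_ideal 1 :: 'p padic set)"
    by (simp add: algebra_simps)
  then obtain c where c: "2 * a + 1 = CARD('p) * c"
    unfolding of_nat_in_padic_ideal_1_iff by (elim dvdE)
  have "0 < CARD('p) * c" "CARD('p) * c < CARD('p) * 2"
    using assms(2) by (simp_all flip: c)
  hence "c = 1" by auto
  thus ?thesis using c by simp
qed

lemma sum_t_poly_square_conv_weighted_t_square_sum:
  fixes x :: "'p :: prime_card padic_int"
  shows "(\<Sum>n = 0..CARD('p) - 1. of_nat (n + 1) * t_poly n x ^ 2)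
     = weighted_t_square_sum (to_fract x)"
proof -
  have "{0..CARD('p) - 1} = {..<CARD('p)}"
    using prime_gt_0_nat[OF prime_card[where 'a = 'p]]
    by (metis Suc_diff_1 atLeast0AtMost lessThan_Suc_atMost)
  thus ?thesis by (simp add: weighted_t_square_sum_def t_poly_def gen_t_poly_def)
qed

lemma Legendre_minus_1:
  assumes "prime p" "p = 2 * a + 1"
  shows "Legendre (- 1) (int p) = (- 1) ^ a"
proof -
  have "[Legendre (- 1) (int p) = (- 1) ^ ((p - 1) div 2)] (mod int p)"
    using assms prime_ge_2_nat[OF assms(1)] by (intro euler_criterion) auto
  hence "int p dvd Legendre (- 1) (int p) - (- 1) ^ a"
    by (simp add: assms(2) cong_iff_dvd_diff)
  moreover have "\<bar>Legendre (- 1) (int p) - (- 1) ^ a\<bar> < int p"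
    using prime_ge_2_nat[OF assms(1)] assms(2) by (auto simp: Legendre_def minus_one_power_iff)
  ultimately show ?thesis by (metis dvd_imp_le_int abs_of_nat eq_iff_diff_eq_0 not_le)
qed

lemma weighted_t_square_sum_cong_if_not_minus_half:
  fixes x :: "'p :: prime_card padic_int"
  assumes odd: "odd CARD('p)" and "\<not> padic_cong (to_fract x) (- 1 / 2) CARD('p)"
  shows "weighted_t_square_sum (to_fract x) - (of_nat CARD('p) / 4
      - (- 1) ^ least_residue x * (2 * to_fract x ^ 2 + 2 * to_fract x - 1)
          * (of_nat CARD('p) + 2 * (to_fract x - of_nat (least_residue x)))
        / (8 * to_fract x + 4)) \<in> padic_ideal 2"
proof -
  define a where "a = least_residue x"
  obtain y where y: "y \<in> padic_integers" and a: "a < CARD('p)"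
    and x: "to_fract x = of_nat a + of_nat CARD('p) * y"
    unfolding a_def by (rule least_residue_decomposition)
  have "2 * to_fract x + 1 \<notin> padic_ideal 1"
    using assms(2) unfolding padic_cong_minus_half_iff[OF odd] .
  from weighted_t_square_sum_cong_unit[OF odd a y this[unfolded x], folded x]
  show ?thesis by (simp add: legendre_ratio_def x algebra_simps flip: a_def)
qed

lemma weighted_t_square_sum_cong_if_minus_half:
  fixes x :: "'p :: prime_card padic_int"
  assumes odd: "odd CARD('p)" and "padic_cong (to_fract x) (- 1 / 2) CARD('p)"
  shows "weighted_t_square_sum (to_fract x)
      - (of_nat CARD('p) / 4 + 3 / 8 * of_int (Legendre (- 1) (int CARD('p)))) \<in> padic_ideal 2"
proof -
  define a where "a = least_residue x"
  obtain y where y: "y \<in> padic_integers" and a: "a < CARD('p)"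
    and x: "to_fract x = of_nat a + of_nat CARD('p) * y"
    unfolding a_def by (rule least_residue_decomposition)
  have "2 * to_fract x + 1 \<in> padic_ideal 1"
    using assms(2) unfolding padic_cong_minus_half_iff[OF odd] .
  hence p: "CARD('p) = 2 * a + 1"
    unfolding x using a y by (rule least_residue_minus_half)
  from weighted_t_square_sum_cong_half[OF p y] show ?thesis
    by (simp add: x Legendre_minus_1[OF prime_card p])
qed

theorem theorem1p2:
  fixes p :: nat
  assumes p: "p = CARD('p :: prime_card)" and odd: "odd p"
  shows "(\<forall>x :: 'p padic_int. \<not> padic_cong (to_fract x) (- 1 / 2) p \<longrightarrow>
           padic_cong (\<Sum>n = 0..p - 1. of_nat (n + 1) * t_poly n x ^ 2)
             (of_nat p / 4
               - (- 1) ^ least_residue x * (2 * to_fract x ^ 2 + 2 * to_fract x - 1)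
                   * (of_nat p + 2 * (to_fract x - of_nat (least_residue x)))
                 / (8 * to_fract x + 4))
             (p ^ 2)) \<and>
         (\<forall>x :: 'p padic_int. padic_cong (to_fract x) (- 1 / 2) p \<longrightarrow>
           padic_cong (\<Sum>n = 0..p - 1. of_nat (n + 1) * t_poly n x ^ 2)
             (of_nat p / 4 + 3 / 8 * of_int (Legendre (- 1) (int p)))
             (p ^ 2))"
  using weighted_t_square_sum_cong_if_not_minus_half[OF odd[unfolded p]]
    weighted_t_square_sum_cong_if_minus_half[OF odd[unfolded p]]
  unfolding p sum_t_poly_square_conv_weighted_t_square_sum padic_cong_iff_padic_ideal by blast

end
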